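(* For any pure state $\rho_{AB}$ on a finite-dimensional bipartite system $AB$, one has $$\log_2\gamma^{\infty}_{\mathrm{SEP}}(\rho_{AB})=H(\rho_A),$$ where $\rho_A=\mathrm{tr}_B[\rho_{AB}]$ and $H(\rho)=-\mathrm{tr}[\rho\log_2\rho]$ is the von Neumann entropy.
   Context: $\mathrm{SEP}(A;B)$ is the set of separable states, i.e. finite convex combinations of product states $\rho_A\otimes\sigma_B$. For a Hermitian operator $\omega$ on $AB$, $\gamma_{\mathrm{SEP}}(\omega)=\inf\{\sum_{i=1}^m|a_i| : m\ge1,\ \omega=\sum_{i=1}^m a_i\tau_i,\ \tau_i\in\mathrm{SEP}(A;B),\ a_i\in\mathbb{R}\}$. For a density operator $\rho$ and $\epsilon\ge0$ the smoothed quasiprobability extent is $\gamma^\epsilon_{\mathrm{SEP}}(\rho)=\min\{\gamma_{\mathrm{SEP}}(\sigma):\sigma\text{ a density operator on }AB,\ \tfrac12\|\rho-\sigma\|_1\le\epsilon\}$. The asymptotic quasiprobability extent is $\gamma^\infty_{\mathrm{SEP}}(\rho)=\lim_{\epsilon\to0^+}\liminf_{n\to\infty}\gamma^\epsilon_{\mathrm{SEP}}(\rho^{\otimes n})^{1/n}$, where $\rho^{\otimes n}$ is viewed as bipartite between $A^{\otimes n}$ and $B^{\otimes n}$. *)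

theory Defs
  imports
    "HOL-Library.Extended_Real"
    "Jordan_Normal_Form.Schur_Decomposition"
begin

text \<open>
  A finite-dimensional system of dimension \<open>d\<close> is \<open>\<complex>\<^sup>d\<close> with its standard basis, and operators
  are complex \<open>d \<times> d\<close> matrices.  In a bipartite system \<open>AB\<close> with local dimensions \<open>dA\<close>, \<open>dB\<close>,
  the product basis vector \<open>e\<^sub>a \<otimes> f\<^sub>b\<close> has index \<open>a * dB + b\<close>.
\<close>

definition mat_trace :: "complex mat \<Rightarrow> complex" where
  "mat_trace A = (\<Sum>i<dim_row A. A $$ (i, i))"

definition hermitian :: "complex mat \<Rightarrow> bool" where
  "hermitian A \<longleftrightarrow> mat_adjoint A = A"

definition positive_semidef :: "complex mat \<Rightarrow> bool" where
  "positive_semidef A \<longleftrightarrow> hermitian A \<and>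
     (\<forall>v \<in> carrier_vec (dim_row A). 0 \<le> Re ((A *\<^sub>v v) \<bullet>c v))"

definition density_operator :: "nat \<Rightarrow> complex mat \<Rightarrow> bool" where
  "density_operator d \<rho> \<longleftrightarrow> \<rho> \<in> carrier_mat d d \<and> positive_semidef \<rho> \<and> mat_trace \<rho> = 1"

definition pure_state :: "nat \<Rightarrow> complex mat \<Rightarrow> bool" where
  "pure_state d \<rho> \<longleftrightarrow> (\<exists>\<psi> \<in> carrier_vec d. \<psi> \<bullet>c \<psi> = 1 \<and>
     \<rho> = mat d d (\<lambda>(i, j). \<psi> $ i * cnj (\<psi> $ j)))"

definition unitary :: "complex mat \<Rightarrow> bool" where
  "unitary U \<longleftrightarrow> square_mat U \<and>
     mat_adjoint U * U = 1\<^sub>m (dim_row U) \<and> U * mat_adjoint U = 1\<^sub>m (dim_row U)"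

text \<open>
  Functional calculus for a Hermitian matrix \<open>A\<close>: if \<open>A = U diag(x) U\<^sup>*\<close> then
  \<open>f(A) = U diag(f(x)) U\<^sup>*\<close>.  The result does not depend on the diagonalisation.
\<close>

definition hermitian_fun :: "(real \<Rightarrow> real) \<Rightarrow> complex mat \<Rightarrow> complex mat" where
  "hermitian_fun f A = (THE M. \<exists>U x. U \<in> carrier_mat (dim_row A) (dim_row A) \<and> unitary U \<and>
     A = U * mat_diag (dim_row A) (\<lambda>i. complex_of_real (x i)) * mat_adjoint U \<and>
     M = U * mat_diag (dim_row A) (\<lambda>i. complex_of_real (f (x i))) * mat_adjoint U)"

definition trace_norm :: "complex mat \<Rightarrow> real" where
  "trace_norm X = Re (mat_trace (hermitian_fun sqrt (mat_adjoint X * X)))"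

text \<open>The convention \<open>0 log 0 = 0\<close> is automatic: the real number \<open>log 2 0\<close> gets multiplied by \<open>0\<close>.\<close>

definition von_neumann_entropy :: "complex mat \<Rightarrow> real" where
  "von_neumann_entropy \<rho> = - Re (mat_trace (\<rho> * hermitian_fun (log 2) \<rho>))"

definition partial_trace_B :: "nat \<Rightarrow> nat \<Rightarrow> complex mat \<Rightarrow> complex mat" where
  "partial_trace_B dA dB \<rho> =
     mat dA dA (\<lambda>(i, j). \<Sum>k<dB. \<rho> $$ (i * dB + k, j * dB + k))"

definition kron :: "complex mat \<Rightarrow> complex mat \<Rightarrow> complex mat" where
  "kron X Y = mat (dim_row X * dim_row Y) (dim_col X * dim_col Y)
     (\<lambda>(i, j). X $$ (i div dim_row Y, j div dim_col Y) * Y $$ (i mod dim_row Y, j mod dim_col Y))"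

text \<open>
  \<open>\<rho>\<^sup>\<otimes>\<^sup>n\<close> as an operator on the bipartite system with local dimensions \<open>dA ^ n\<close> and \<open>dB ^ n\<close>.
  An index \<open>a\<close> of \<open>A\<^sup>\<otimes>\<^sup>n\<close> is the \<open>n\<close>-tuple of its base-\<open>dA\<close> digits, likewise for \<open>B\<close>, and
  \<open>copy_index dA dB n k I\<close> is the index, within the \<open>k\<close>-th copy of \<open>AB\<close>, of the pair formed by the
  \<open>k\<close>-th digits of \<open>a\<close> and \<open>b\<close>, where \<open>I = a * dB ^ n + b\<close>.
\<close>

definition copy_index :: "nat \<Rightarrow> nat \<Rightarrow> nat \<Rightarrow> nat \<Rightarrow> nat \<Rightarrow> nat" where
  "copy_index dA dB n k I =
     ((I div dB ^ n) div dA ^ k mod dA) * dB + ((I mod dB ^ n) div dB ^ k mod dB)"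

definition bipartite_tensor_power :: "nat \<Rightarrow> nat \<Rightarrow> nat \<Rightarrow> complex mat \<Rightarrow> complex mat" where
  "bipartite_tensor_power dA dB n \<rho> = mat (dA ^ n * dB ^ n) (dA ^ n * dB ^ n)
     (\<lambda>(I, J). \<Prod>k<n. \<rho> $$ (copy_index dA dB n k I, copy_index dA dB n k J))"

definition real_lincomb :: "nat \<Rightarrow> nat \<Rightarrow> (nat \<Rightarrow> real) \<Rightarrow> (nat \<Rightarrow> complex mat) \<Rightarrow> complex mat" where
  "real_lincomb d m a T = mat d d (\<lambda>ij. \<Sum>k<m. complex_of_real (a k) * T k $$ ij)"

definition SEP :: "nat \<Rightarrow> nat \<Rightarrow> complex mat set" where
  "SEP dA dB = {real_lincomb (dA * dB) m p (\<lambda>k. kron (\<alpha> k) (\<beta> k)) | m p \<alpha> \<beta>.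
     (\<forall>k<m. 0 \<le> p k \<and> density_operator dA (\<alpha> k) \<and> density_operator dB (\<beta> k)) \<and>
     (\<Sum>k<m. p k) = 1}"

text \<open>
  The infimum is over a nonempty set for every Hermitian \<open>\<omega>\<close>, since \<open>SEP\<close> spans the real space of
  Hermitian operators.
\<close>

definition gamma_SEP :: "nat \<Rightarrow> nat \<Rightarrow> complex mat \<Rightarrow> real" where
  "gamma_SEP dA dB \<omega> = Inf {\<Sum>i<m. \<bar>a i\<bar> | m a \<tau>.
     1 \<le> m \<and> (\<forall>i<m. \<tau> i \<in> SEP dA dB) \<and> \<omega> = real_lincomb (dA * dB) m a \<tau>}"

text \<open>
  For a density operator \<open>\<rho>\<close> and \<open>\<epsilon> \<ge> 0\<close> this infimum is a minimum: \<open>\<rho>\<close> itself is feasible, the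
  feasible set is compact, and \<open>gamma_SEP\<close> is a norm on Hermitian operators.
\<close>

definition smoothed_gamma_SEP :: "nat \<Rightarrow> nat \<Rightarrow> real \<Rightarrow> complex mat \<Rightarrow> real" where
  "smoothed_gamma_SEP dA dB \<epsilon> \<rho> = Inf {gamma_SEP dA dB \<sigma> | \<sigma>.
     density_operator (dA * dB) \<sigma> \<and> 1 / 2 * trace_norm (\<rho> - \<sigma>) \<le> \<epsilon>}"

text \<open>
  The limit from the right exists because the inner expression is nonincreasing in \<open>\<epsilon> > 0\<close>.
\<close>

definition asymptotic_gamma_SEP :: "nat \<Rightarrow> nat \<Rightarrow> complex mat \<Rightarrow> ereal" where
  "asymptotic_gamma_SEP dA dB \<rho> = Lim (at_right 0) (\<lambda>\<epsilon>. liminf (\<lambda>n.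
     ereal (root n (smoothed_gamma_SEP (dA ^ n) (dB ^ n) \<epsilon> (bipartite_tensor_power dA dB n \<rho>)))))"

definition log2_ereal :: "ereal \<Rightarrow> ereal" where
  "log2_ereal x = (if x \<le> 0 then -\<infinity> else if x = \<infinity> then \<infinity> else ereal (log 2 (real_of_ereal x)))"

end

(*
  Write psi = sum_i u_i (x) w_i with u_i an orthonormal eigenbasis of rho_A and w_i orthogonal of
  squared norms p_i, so that H(rho_A) = H(p).  The n-th power has the same form, indexed by words I
  with weights p_I.  Let T be the set of words with 2^(-n(H+d)) <= p_I <= 2^(-n(H-d)), and let f be
  the part of psi^(x)n supported on T; by Chebyshev the squared norm q of f tends to 1.

  Lower bound: |<f|a (x) b>|^2 <= 2^(-n(H-d)) for product unit vectors, so <f|.|f> is at most that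
  small on SEP, whereas <f|sigma|f> >= q^2 - 2 eps for every sigma within eps of psi^(x)n.

  Upper bound: the normalisation of f is close to psi^(x)n.  Each coherence between two of its
  product terms is a combination of boundedly many product states, so its quasiprobability extent
  is at most 10 |T| <= 10 * 2^(n(H+d)).

  Hence for every 0 < eps < 1/4 the liminf of the n-th roots already equals 2^H.
*)

theory Submission
  imports Defs "Jordan_Normal_Form.Spectral_Radius" "HOL-Analysis.L2_Norm"
begin

section \<open>Spectral theorem for Hermitian matrices\<close>

text \<open>The overlap bound is Cauchy-Schwarz over the words of T followed by Bessel on each side:
  the vectors on A are orthonormal, those on B orthogonal with squared norms at most the largest
  weight in T. The vectors on B stay unnormalised throughout, so words of weight 0 need no separate
  treatment and the cost of a coherence between words I and J is proportional to p_I + p_J. Summed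
  over all pairs this gives 10 |T| q, and q cancels when f is normalised. The two sides of the
  typicality condition do different work: the lower cut bounds the number of words, the upper cut
  bounds the overlap with product vectors.

  Two definitions stay opaque until something is proved about them. Functional calculus is a
  definite description, so trace norm and entropy become computable only through a spectral theorem
  and the independence of the diagonalisation. A real infimum is informative only over a nonempty
  set bounded below, so every Hermitian operator must first be shown to have some finite
  decomposition into separable states. The prefactors 10 and 1/4 vanish under the n-th root.\<close>

lemma mat_adjoint_altdef:
  fixes A :: "complex mat"
  shows "mat_adjoint A = mat (dim_col A) (dim_row A) (\<lambda>(i, j). cnj (A $$ (j, i)))"
  by (rule eq_matI) (auto simp: mat_adjoint_def mat_of_rows_def)

lemma mat_adjoint_dim [simp]:
  fixes A :: "complex mat"
  shows "dim_row (mat_adjoint A) = dim_col A" "dim_col (mat_adjoint A) = dim_row A"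
  by (auto simp: mat_adjoint_altdef)

lemma mat_adjoint_carrier [simp]:
  fixes A :: "complex mat"
  shows "A \<in> carrier_mat n m \<Longrightarrow> mat_adjoint A \<in> carrier_mat m n"
  by (auto simp: mat_adjoint_altdef)

lemma mat_adjoint_index [simp]:
  fixes A :: "complex mat"
  shows "i < dim_col A \<Longrightarrow> j < dim_row A \<Longrightarrow> mat_adjoint A $$ (i, j) = cnj (A $$ (j, i))"
  by (auto simp: mat_adjoint_altdef)

lemma mat_adjoint_mult:
  fixes A B :: "complex mat"
  assumes "A \<in> carrier_mat n m" "B \<in> carrier_mat m k"
  shows "mat_adjoint (A * B) = mat_adjoint B * mat_adjoint A"
  using assms by (intro eq_matI) (auto simp: scalar_prod_def mult.commute)

lemma hermitian_index:
  assumes "X \<in> carrier_mat d d"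
  shows "hermitian X \<longleftrightarrow> (\<forall>i<d. \<forall>j<d. X $$ (j, i) = cnj (X $$ (i, j)))"
proof
  assume "hermitian X"
  then have eq: "mat_adjoint X = X" by (simp add: hermitian_def)
  show "\<forall>i<d. \<forall>j<d. X $$ (j, i) = cnj (X $$ (i, j))"
  proof (intro allI impI)
    fix i j assume "i < d" "j < d"
    then show "X $$ (j, i) = cnj (X $$ (i, j))"
      using assms mat_adjoint_index[of j X i] unfolding eq by auto
  qed
next
  assume "\<forall>i<d. \<forall>j<d. X $$ (j, i) = cnj (X $$ (i, j))"
  then have "mat_adjoint X $$ (i, j) = X $$ (i, j)" if "i < d" "j < d" for i j
    using assms that mat_adjoint_index[of i X j] by (metis carrier_matD)
  then show "hermitian X"
    unfolding hermitian_def using assms by (intro eq_matI) auto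
qed

text \<open>An eigenvector exists because complex spectra are nonempty. Its quadratic form equals
  its own conjugate, so the eigenvalue is real. The sign condition on the first coordinate, reached
  by a phase, is what \<open>householder\<close> asks for.\<close>

lemma hermitian_unit_eigenvector:
  assumes A: "A \<in> carrier_mat (Suc n) (Suc n)" and herm: "hermitian A"
  obtains v and t :: real where "v \<in> carrier_vec (Suc n)" "A *\<^sub>v v = complex_of_real t \<cdot>\<^sub>v v"
    "(\<Sum>i<Suc n. v $ i * cnj (v $ i)) = 1" "\<exists>a\<ge>0. v $ 0 = - complex_of_real a"
proof -
  obtain k where "k \<in> spectrum A" using spectrum_non_empty[OF A] by auto
  then obtain u where u: "u \<in> carrier_vec (Suc n)" "u \<noteq> 0\<^sub>v (Suc n)" "A *\<^sub>v u = k \<cdot>\<^sub>v u"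
    using A by (auto simp: spectrum_def eigenvalue_def eigenvector_def)
  define N where "N = (\<Sum>i<Suc n. (cmod (u $ i))\<^sup>2)"
  have N: "N > 0"
  proof -
    obtain i where "i < Suc n" "u $ i \<noteq> 0"
      using u(1,2) eq_vecI[of u "0\<^sub>v (Suc n)"] by auto
    then show ?thesis unfolding N_def by (intro sum_pos2[of _ i]) auto
  qed
  have Nc: "(\<Sum>i<Suc n. u $ i * cnj (u $ i)) = complex_of_real N"
    unfolding N_def of_real_sum by (simp only: complex_norm_square)
  have ent: "(\<Sum>j<Suc n. A $$ (i, j) * u $ j) = k * u $ i" if "i < Suc n" for i
  proof -
    have "(A *\<^sub>v u) $ i = k * u $ i" using u that by simp
    then show ?thesis using A u(1) that
      by (simp add: scalar_prod_def atLeast0LessThan del: sum.lessThan_Suc)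
  qed
  have q1: "(\<Sum>i<Suc n. \<Sum>j<Suc n. cnj (u $ i) * A $$ (i, j) * u $ j) = k * N"
  proof -
    have "(\<Sum>i<Suc n. \<Sum>j<Suc n. cnj (u $ i) * A $$ (i, j) * u $ j)
        = (\<Sum>i<Suc n. cnj (u $ i) * (\<Sum>j<Suc n. A $$ (i, j) * u $ j))"
      by (simp add: sum_distrib_left mult.assoc del: sum.lessThan_Suc)
    also have "\<dots> = (\<Sum>i<Suc n. cnj (u $ i) * (k * u $ i))"
      by (intro sum.cong refl) (simp add: ent del: sum.lessThan_Suc)
    also have "\<dots> = k * (\<Sum>i<Suc n. u $ i * cnj (u $ i))"
      by (simp add: sum_distrib_left mult_ac del: sum.lessThan_Suc)
    finally show ?thesis unfolding Nc .
  qed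
  have hA: "cnj (A $$ (i, j)) = A $$ (j, i)" if "i < Suc n" "j < Suc n" for i j
    using herm that unfolding hermitian_index[OF A] by metis
  have "cnj (k * N) = (\<Sum>i<Suc n. \<Sum>j<Suc n. u $ i * cnj (A $$ (i, j)) * cnj (u $ j))"
    unfolding q1[symmetric] by (simp del: sum.lessThan_Suc)
  also have "\<dots> = (\<Sum>i<Suc n. \<Sum>j<Suc n. cnj (u $ j) * A $$ (j, i) * u $ i)"
    by (intro sum.cong refl) (simp add: hA mult_ac del: sum.lessThan_Suc)
  also have "\<dots> = k * N" unfolding q1[symmetric] by (rule sum.swap)
  finally have "cnj k = k" using N by simp
  then obtain t where kr: "k = complex_of_real t" by (metis Reals_cnj_iff Reals_cases)
  \<comment> \<open>A phase that turns \<open>u $ 0\<close> into \<open>- cmod (u $ 0)\<close>. For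
    \<open>u $ 0 = 0\<close> the value 1 avoids a division by 0, which would spoil
    \<open>cmod c = 1\<close>.\<close>
  define c where "c = (if u $ 0 = 0 then 1 else - cnj (u $ 0) / complex_of_real (cmod (u $ 0)))"
  have c1: "cmod c = 1" by (auto simp: c_def norm_divide)
  have c0: "c * u $ 0 = - complex_of_real (cmod (u $ 0))"
  proof (cases "u $ 0 = 0")
    case False
    have "c * u $ 0 = - (u $ 0 * cnj (u $ 0)) / complex_of_real (cmod (u $ 0))"
      using False by (simp add: c_def mult.commute)
    also have "\<dots> = - complex_of_real (cmod (u $ 0))"
      using False by (simp flip: complex_norm_square add: power2_eq_square)
    finally show ?thesis .
  qed (simp add: c_def)
  define s where "s = c / complex_of_real (sqrt N)"
  define v where "v = s \<cdot>\<^sub>v u"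
  have s2: "s * cnj s = 1 / N"
  proof -
    have "cmod s = 1 / sqrt N" using N by (simp add: s_def norm_divide c1)
    then have "(cmod s)\<^sup>2 = 1 / N" using N by (simp add: power_divide)
    then show ?thesis by (metis complex_norm_square of_real_1 of_real_divide)
  qed
  show thesis
  proof
    show "v \<in> carrier_vec (Suc n)" using u by (simp add: v_def)
    show "A *\<^sub>v v = complex_of_real t \<cdot>\<^sub>v v"
      using A u kr[symmetric] by (simp add: v_def mult_mat_vec smult_smult_assoc mult.commute)
    have "(\<Sum>i<Suc n. v $ i * cnj (v $ i)) = s * cnj s * (\<Sum>i<Suc n. u $ i * cnj (u $ i))"
      unfolding sum_distrib_left using u
      by (intro sum.cong) (auto simp: v_def mult_ac)
    then show "(\<Sum>i<Suc n. v $ i * cnj (v $ i)) = 1" unfolding Nc s2 using N by simp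
    have "v $ 0 = c * u $ 0 / complex_of_real (sqrt N)" using u by (simp add: v_def s_def)
    then have "v $ 0 = - complex_of_real (cmod (u $ 0) / sqrt N)" unfolding c0 by simp
    then show "\<exists>a\<ge>0. v $ 0 = - complex_of_real a" using N
      by (metis divide_nonneg_nonneg norm_ge_zero order_less_imp_le real_sqrt_ge_zero)
  qed
qed

text \<open>Non-positivity of \<open>v $ 0\<close> keeps the reflection axis \<open>v - e\<^sub>0\<close> away from \<open>0\<close>.\<close>

lemma householder:
  assumes v: "v \<in> carrier_vec (Suc n)" and v1: "(\<Sum>i<Suc n. v $ i * cnj (v $ i)) = 1"
    and v0: "v $ 0 = - complex_of_real a" "a \<ge> 0"
  obtains V where "V \<in> carrier_mat (Suc n) (Suc n)" "mat_adjoint V = V" "V * V = 1\<^sub>m (Suc n)"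
    "\<And>i. i < Suc n \<Longrightarrow> V $$ (i, 0) = v $ i"
proof -
  define w where "w i = v $ i - (if i = 0 then 1 else 0)" for i :: nat
  \<comment> \<open>The reflection 1 - 2 w w^* / |w|^2 with w = v - e_0. Here |w|^2 = 2 (1 + a), so
    the factor 2 cancels. Column 0 is v because w_0 = -(1 + a).\<close>
  define V where "V = mat (Suc n) (Suc n)
    (\<lambda>(i, j). (if i = j then 1 else 0) - w i * cnj (w j) / complex_of_real (1 + a))"
  have ww: "(\<Sum>i<Suc n. cnj (w i) * w i) = 2 * complex_of_real (1 + a)"
  proof -
    have "(\<Sum>i<Suc n. cnj (w i) * w i) = (\<Sum>i<Suc n. v $ i * cnj (v $ i)
        + (if i = 0 then 1 - v $ i - cnj (v $ i) else 0))"
      by (intro sum.cong) (auto simp: w_def algebra_simps)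
    also have "\<dots> = (\<Sum>i<Suc n. v $ i * cnj (v $ i)) + (1 - v $ 0 - cnj (v $ 0))"
      by (simp only: sum.distrib) (simp del: sum.lessThan_Suc add: sum.delta)
    finally show ?thesis unfolding v1 v0 by simp
  qed
  have a1: "complex_of_real (1 + a) \<noteq> 0" using v0 by (simp flip: of_real_add)
  show thesis
  proof
    show V: "V \<in> carrier_mat (Suc n) (Suc n)" by (simp add: V_def)
    show "mat_adjoint V = V" by (rule eq_matI) (auto simp: V_def)
    show "V * V = 1\<^sub>m (Suc n)"
    proof (rule eq_matI)
      fix i j assume "i < dim_row (1\<^sub>m (Suc n))" "j < dim_col (1\<^sub>m (Suc n))"
      then have ij: "i < Suc n" "j < Suc n" by auto
      define b where "b = complex_of_real (1 + a)"
      have "(V * V) $$ (i, j) = (\<Sum>k<Suc n. V $$ (i, k) * V $$ (k, j))"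
        using V ij by (simp add: scalar_prod_def atLeast0LessThan del: sum.lessThan_Suc)
      also have "\<dots> = (\<Sum>k<Suc n. (if k = i then (if i = j then 1 else 0) - w i * cnj (w j) / b else 0)
          - (if k = j then w i * cnj (w j) / b else 0)
          + w i * cnj (w j) / (b * b) * (cnj (w k) * w k))"
        using ij unfolding V_def b_def[symmetric] by (intro sum.cong) (auto simp: algebra_simps)
      also have "\<dots> = (if i = j then 1 else 0) - w i * cnj (w j) / b - w i * cnj (w j) / b
          + w i * cnj (w j) / (b * b) * (\<Sum>k<Suc n. cnj (w k) * w k)"
        using ij by (simp add: sum.distrib sum_subtractf sum_distrib_left del: sum.lessThan_Suc)
      also have "\<dots> = (if i = j then 1 else 0)"
        unfolding ww b_def[symmetric] using a1 by (simp add: b_def[symmetric] field_simps)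
      finally show "(V * V) $$ (i, j) = 1\<^sub>m (Suc n) $$ (i, j)" using ij by simp
    qed (auto simp: V_def)
    show "V $$ (i, 0) = v $ i" if "i < Suc n" for i
      using that v0 a1 by (auto simp: V_def w_def field_simps)
  qed
qed

lemma unitaryI:
  assumes "U \<in> carrier_mat n n" "mat_adjoint U * U = 1\<^sub>m n"
  shows "unitary U"
  using assms mat_mult_left_right_inverse[of "mat_adjoint U" n U]
  by (auto simp: unitary_def square_mat.simps)

lemma block_diagonal_mult:
  fixes A A' :: "complex mat"
  assumes A: "A \<in> carrier_mat m m" "A' \<in> carrier_mat m m"
    and D: "D \<in> carrier_mat n n" "D' \<in> carrier_mat n n"
  shows "four_block_mat A (0\<^sub>m m n) (0\<^sub>m n m) D * four_block_mat A' (0\<^sub>m m n) (0\<^sub>m n m) D'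
    = four_block_mat (A * A') (0\<^sub>m m n) (0\<^sub>m n m) (D * D')"
  using assms
  by (subst mult_four_block_mat[OF A(1) zero_carrier_mat zero_carrier_mat D(1)
        A(2) zero_carrier_mat zero_carrier_mat D(2)]) simp

text \<open>Deflation by induction on the dimension. The reflection V maps e_0 to a unit
  eigenvector, so V A V has first column t e_0; being Hermitian it is then block diagonal, and the
  induction hypothesis diagonalises the lower block.\<close>

lemma spectral_decomposition:
  assumes "A \<in> carrier_mat n n" "hermitian A"
  shows "\<exists>U x. U \<in> carrier_mat n n \<and> unitary U \<and>
    A = U * mat_diag n (\<lambda>i. complex_of_real (x i)) * mat_adjoint U"
  using assms
proof (induction n arbitrary: A)
  case 0
  then show ?case
    by (intro exI[of _ "1\<^sub>m 0"] exI[of _ "\<lambda>_. 0"]) (auto intro!: unitaryI eq_matI)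
next
  case (Suc n)
  note A = Suc.prems(1)
  let ?N = "Suc n"
  obtain v t where v: "v \<in> carrier_vec ?N" "A *\<^sub>v v = complex_of_real t \<cdot>\<^sub>v v"
      "(\<Sum>i<?N. v $ i * cnj (v $ i)) = 1" "\<exists>a\<ge>0. v $ 0 = - complex_of_real a"
    using hermitian_unit_eigenvector[OF Suc.prems] by blast
  obtain V where V: "V \<in> carrier_mat ?N ?N" "mat_adjoint V = V" "V * V = 1\<^sub>m ?N"
      "\<And>i. i < ?N \<Longrightarrow> V $$ (i, 0) = v $ i"
  proof -
    obtain a where "a \<ge> 0" "v $ 0 = - complex_of_real a" using v(4) by blast
    then show thesis using householder[OF v(1) v(3)] that by blast
  qed
  define B where "B = V * (A * V)"
  have B: "B \<in> carrier_mat ?N ?N" using V A by (simp add: B_def)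
  have hB: "hermitian B"
    unfolding hermitian_def B_def using V A Suc.prems(2)
    by (simp add: mat_adjoint_mult[of _ ?N ?N _ ?N] hermitian_def)
  have colV: "col V 0 = v" using V v(1) by (intro eq_vecI) auto
  have VAVcol: "col (A * V) 0 = complex_of_real t \<cdot>\<^sub>v v"
    using V A v(2) colV by (metis col_mult2 zero_less_Suc)
  have colB: "B $$ (i, 0) = (if i = 0 then complex_of_real t else 0)" if i: "i < ?N" for i
  proof -
    have "B $$ (i, 0) = row V i \<bullet> (complex_of_real t \<cdot>\<^sub>v v)"
      unfolding B_def VAVcol[symmetric] using V A i by simp
    also have "\<dots> = complex_of_real t * (row V i \<bullet> col V 0)"
      unfolding colV using V(1) v(1) i by simp
    also have "row V i \<bullet> col V 0 = (V * V) $$ (i, 0)" using V(1) i by simp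
    also have "\<dots> = (if i = 0 then 1 else 0)" unfolding V(3) using i by simp
    finally show ?thesis by simp
  qed
  define C where "C = mat n n (\<lambda>(i, j). B $$ (Suc i, Suc j))"
  have Bherm: "B $$ (j, i) = cnj (B $$ (i, j))" if "i < ?N" "j < ?N" for i j
    using hB that unfolding hermitian_index[OF B] by blast
  have "hermitian C"
    by (subst hermitian_index[of _ n]) (auto simp: C_def intro!: Bherm)
  then obtain U' x' where U': "U' \<in> carrier_mat n n" "unitary U'"
      "C = U' * mat_diag n (\<lambda>i. complex_of_real (x' i)) * mat_adjoint U'"
    using Suc.IH[of C] by (auto simp: C_def)
  define W where "W = four_block_mat (1\<^sub>m 1) (0\<^sub>m 1 n) (0\<^sub>m n 1) U'"
  define x where "x i = (case i of 0 \<Rightarrow> t | Suc k \<Rightarrow> x' k)" for i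
  have W: "W \<in> carrier_mat ?N ?N" using U' by (intro carrier_matI) (auto simp: W_def)
  have adjW: "mat_adjoint W = four_block_mat (1\<^sub>m 1) (0\<^sub>m 1 n) (0\<^sub>m n 1) (mat_adjoint U')"
    using U'(1) by (intro eq_matI) (auto simp: W_def)
  have D: "mat_diag ?N (\<lambda>i. complex_of_real (x i)) =
      four_block_mat (mat_diag 1 (\<lambda>_. complex_of_real t)) (0\<^sub>m 1 n) (0\<^sub>m n 1)
        (mat_diag n (\<lambda>i. complex_of_real (x' i)))"
    by (rule eq_matI) (auto simp: x_def mat_diag_def split: nat.splits)
  have BW: "B = W * mat_diag ?N (\<lambda>i. complex_of_real (x i)) * mat_adjoint W"
  proof -
    have "W * mat_diag ?N (\<lambda>i. complex_of_real (x i)) * mat_adjoint W =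
        four_block_mat (mat_diag 1 (\<lambda>_. complex_of_real t)) (0\<^sub>m 1 n) (0\<^sub>m n 1) C"
      unfolding adjW D unfolding W_def U'(3) using U'(1)
      by (simp add: block_diagonal_mult mat_diag_def)
    also have "\<dots> = B"
    proof (rule eq_matI)
      fix i j assume "i < dim_row B" "j < dim_col B"
      then have ij: "i < ?N" "j < ?N" using B by auto
      \<comment> \<open>Hermiticity transfers the known first column to the first row, which makes
        the off-diagonal blocks vanish.\<close>
      have "B $$ (0, j) = (if j = 0 then complex_of_real t else 0)"
        using Bherm[of j 0] colB[of j] ij by auto
      then show "four_block_mat (mat_diag 1 (\<lambda>_. complex_of_real t)) (0\<^sub>m 1 n) (0\<^sub>m n 1) C $$ (i, j) = B $$ (i, j)"
        using ij colB[of i] by (auto simp: C_def mat_diag_def)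
    qed (use B in \<open>auto simp: C_def mat_diag_def\<close>)
    finally show ?thesis by simp
  qed
  have adjWW: "mat_adjoint W * W = 1\<^sub>m ?N"
  proof -
    have "mat_adjoint W * W = four_block_mat (1\<^sub>m 1) (0\<^sub>m 1 n) (0\<^sub>m n 1) (1\<^sub>m n)"
      unfolding adjW unfolding W_def using U'(1,2)
      by (simp add: block_diagonal_mult unitary_def)
    also have "\<dots> = 1\<^sub>m ?N" by (rule eq_matI) auto
    finally show ?thesis .
  qed
  define U where "U = V * W"
  let ?D = "mat_diag ?N (\<lambda>i. complex_of_real (x i))"
  have Dc: "?D \<in> carrier_mat ?N ?N" by (simp add: mat_diag_def)
  have U: "U \<in> carrier_mat ?N ?N" using V W by (simp add: U_def)
  have adjU: "mat_adjoint U = mat_adjoint W * V"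
    unfolding U_def using V W by (simp add: mat_adjoint_mult[of _ ?N ?N _ ?N])
  have "mat_adjoint U * U = mat_adjoint W * ((V * V) * W)"
    unfolding adjU unfolding U_def using V(1) W
    by (simp add: assoc_mult_mat[of _ ?N ?N _ ?N _ ?N] mult_carrier_mat[of _ ?N ?N _ ?N])
  then have "unitary U" using V W adjWW by (intro unitaryI[OF U]) simp
  moreover have "A = U * ?D * mat_adjoint U"
  proof -
    have "A = (V * V) * A * (V * V)" unfolding V(3) using A by simp
    also have "\<dots> = V * B * V" unfolding B_def using V(1) A
      by (simp add: assoc_mult_mat[of _ ?N ?N _ ?N _ ?N] mult_carrier_mat[of _ ?N ?N _ ?N])
    also have "\<dots> = U * ?D * mat_adjoint U" unfolding BW adjU unfolding U_def using V(1) W Dc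
      by (simp add: assoc_mult_mat[of _ ?N ?N _ ?N _ ?N] mult_carrier_mat[of _ ?N ?N _ ?N])
    finally show ?thesis .
  qed
  ultimately show ?case using U by blast
qed

section \<open>Rank-one operators, trace norm and entropy\<close>

text \<open>Vectors are plain functions read only below the dimension, so sums, slices and tensor
  products of vectors carry no side conditions. The form is conjugate-linear in its first argument,
  whereas \<open>\<bullet>c\<close> conjugates the second.\<close>

definition cip :: "nat \<Rightarrow> (nat \<Rightarrow> complex) \<Rightarrow> (nat \<Rightarrow> complex) \<Rightarrow> complex" where
  "cip d f g = (\<Sum>i<d. cnj (f i) * g i)"

definition nsq :: "nat \<Rightarrow> (nat \<Rightarrow> complex) \<Rightarrow> real" where
  "nsq d f = (\<Sum>i<d. (cmod (f i))\<^sup>2)"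

definition rank1 :: "nat \<Rightarrow> (nat \<Rightarrow> complex) \<Rightarrow> complex mat" where
  "rank1 d f = mat d d (\<lambda>(i, j). f i * cnj (f j))"

definition bform :: "nat \<Rightarrow> (nat \<Rightarrow> complex) \<Rightarrow> complex mat \<Rightarrow> (nat \<Rightarrow> complex) \<Rightarrow> complex" where
  "bform d f X g = (\<Sum>i<d. \<Sum>j<d. cnj (f i) * X $$ (i, j) * g j)"

text \<open>The two clauses are U^* U = 1 and U U^* = 1 for the matrix with columns
  \<open>e r\<close>: orthonormality and completeness. The second is the one behind expansions in
  the basis.\<close>

definition onb :: "nat \<Rightarrow> (nat \<Rightarrow> nat \<Rightarrow> complex) \<Rightarrow> bool" where
  "onb d e \<longleftrightarrow> (\<forall>r<d. \<forall>s<d. cip d (e r) (e s) = (if r = s then 1 else 0)) \<and>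
     (\<forall>i<d. \<forall>j<d. (\<Sum>r<d. e r i * cnj (e r j)) = (if i = j then 1 else 0))"

definition spec_mat :: "nat \<Rightarrow> (nat \<Rightarrow> nat \<Rightarrow> complex) \<Rightarrow> (nat \<Rightarrow> real) \<Rightarrow> complex mat" where
  "spec_mat d e x = mat d d (\<lambda>(i, j). \<Sum>r<d. complex_of_real (x r) * e r i * cnj (e r j))"

lemma cip_self: "cip d f f = complex_of_real (nsq d f)"
  unfolding cip_def nsq_def of_real_sum by (simp add: complex_norm_square mult.commute del: of_real_power)

lemma nsq_nonneg [simp]: "0 \<le> nsq d f"
  by (simp add: nsq_def sum_nonneg)

lemma cnj_cip: "cnj (cip d f g) = cip d g f"
  by (simp add: cip_def mult.commute)

lemma cmod_cip_commute: "cmod (cip d f g) = cmod (cip d g f)"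
  by (metis cnj_cip complex_mod_cnj)

lemma cmod_sum_mult_le:
  fixes f g :: "'i \<Rightarrow> complex"
  shows "(cmod (\<Sum>i\<in>A. f i * g i))\<^sup>2 \<le> (\<Sum>i\<in>A. (cmod (f i))\<^sup>2) * (\<Sum>i\<in>A. (cmod (g i))\<^sup>2)"
proof -
  have "cmod (\<Sum>i\<in>A. f i * g i) \<le> (\<Sum>i\<in>A. cmod (f i) * cmod (g i))"
    by (rule order_trans[OF norm_sum]) (simp add: norm_mult)
  also have "\<dots> \<le> L2_set (\<lambda>i. cmod (f i)) A * L2_set (\<lambda>i. cmod (g i)) A"
    using L2_set_mult_ineq[of "\<lambda>i. cmod (f i)" "\<lambda>i. cmod (g i)" A] by simp
  finally have "(cmod (\<Sum>i\<in>A. f i * g i))\<^sup>2 \<le> (L2_set (\<lambda>i. cmod (f i)) A * L2_set (\<lambda>i. cmod (g i)) A)\<^sup>2"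
    by (rule power_mono) simp
  then show ?thesis by (simp add: L2_set_def power_mult_distrib sum_nonneg)
qed

lemma cip_cauchy_schwarz: "(cmod (cip d f g))\<^sup>2 \<le> nsq d f * nsq d g"
  using cmod_sum_mult_le[of "\<lambda>i. cnj (f i)" g "{..<d}"] by (simp add: cip_def nsq_def)

lemma rank1_carrier [simp]: "rank1 d f \<in> carrier_mat d d"
  and rank1_dim [simp]: "dim_row (rank1 d f) = d" "dim_col (rank1 d f) = d"
  and rank1_index [simp]: "i < d \<Longrightarrow> j < d \<Longrightarrow> rank1 d f $$ (i, j) = f i * cnj (f j)"
  by (auto simp: rank1_def)

lemma spec_mat_carrier [simp]: "spec_mat d e x \<in> carrier_mat d d"
  and spec_mat_dim [simp]: "dim_row (spec_mat d e x) = d" "dim_col (spec_mat d e x) = d"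
  and spec_mat_index [simp]: "i < d \<Longrightarrow> j < d \<Longrightarrow>
    spec_mat d e x $$ (i, j) = (\<Sum>r<d. complex_of_real (x r) * e r i * cnj (e r j))"
  by (auto simp: spec_mat_def)

lemma onb_cip: "onb d e \<Longrightarrow> r < d \<Longrightarrow> s < d \<Longrightarrow> cip d (e r) (e s) = (if r = s then 1 else 0)"
  by (simp add: onb_def)

lemma onb_nsq: "onb d e \<Longrightarrow> r < d \<Longrightarrow> nsq d (e r) = 1"
  using onb_cip[of d e r r] by (simp add: cip_self)

lemma onb_expansion:
  assumes "onb d e" "i < d"
  shows "(\<Sum>r<d. cip d (e r) f * e r i) = f i"
proof -
  have "(\<Sum>r<d. cip d (e r) f * e r i) = (\<Sum>r<d. \<Sum>j<d. f j * (e r i * cnj (e r j)))"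
    unfolding cip_def sum_distrib_right by (intro sum.cong refl) (simp add: mult_ac)
  also have "\<dots> = (\<Sum>j<d. f j * (\<Sum>r<d. e r i * cnj (e r j)))"
    by (subst sum.swap) (simp add: sum_distrib_left)
  also have "\<dots> = (\<Sum>j<d. f j * (if i = j then 1 else 0))"
    using assms by (intro sum.cong) (auto simp: onb_def)
  also have "\<dots> = f i" using assms(2) by (simp add: if_distrib cong: if_cong)
  finally show ?thesis .
qed

lemma onb_expansion_cnj:
  assumes "onb d e" "i < d"
  shows "(\<Sum>r<d. cip d f (e r) * cnj (e r i)) = cnj (f i)"
  using arg_cong[OF onb_expansion[OF assms, of f], of cnj] by (simp add: cnj_cip)

lemma parseval:
  assumes "onb d e"
  shows "(\<Sum>r<d. (cmod (cip d (e r) f))\<^sup>2) = nsq d f"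
proof -
  have "complex_of_real (\<Sum>r<d. (cmod (cip d (e r) f))\<^sup>2) = (\<Sum>r<d. cip d (e r) f * cip d f (e r))"
    unfolding of_real_sum by (simp add: complex_norm_square cnj_cip del: of_real_power)
  also have "\<dots> = (\<Sum>r<d. \<Sum>i<d. cnj (f i) * (cip d (e r) f * e r i))"
    by (simp add: cip_def[of d f] sum_distrib_left mult_ac)
  also have "\<dots> = (\<Sum>i<d. cnj (f i) * (\<Sum>r<d. cip d (e r) f * e r i))"
    by (subst sum.swap) (simp add: sum_distrib_left)
  also have "\<dots> = cip d f f"
    unfolding cip_def[of d f f] by (intro sum.cong) (auto simp: onb_expansion[OF assms])
  finally show ?thesis by (simp add: cip_self flip: of_real_sum)
qed

lemma bform_spec:
  "bform d f (spec_mat d e x) g = (\<Sum>r<d. complex_of_real (x r) * cip d f (e r) * cip d (e r) g)"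
proof -
  have "bform d f (spec_mat d e x) g
      = (\<Sum>i<d. \<Sum>j<d. \<Sum>r<d. complex_of_real (x r) * (cnj (f i) * e r i) * (cnj (e r j) * g j))"
    unfolding bform_def
    by (intro sum.cong refl)
      (auto simp: sum_distrib_left sum_distrib_right mult_ac intro!: sum.cong)
  also have "\<dots> = (\<Sum>i<d. \<Sum>r<d. \<Sum>j<d. complex_of_real (x r) * (cnj (f i) * e r i) * (cnj (e r j) * g j))"
    by (rule sum.cong[OF refl], rule sum.swap)
  also have "\<dots> = (\<Sum>r<d. \<Sum>i<d. \<Sum>j<d. complex_of_real (x r) * (cnj (f i) * e r i) * (cnj (e r j) * g j))"
    by (rule sum.swap)
  also have "\<dots> = (\<Sum>r<d. complex_of_real (x r) * cip d f (e r) * cip d (e r) g)"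
    unfolding cip_def sum_distrib_left sum_distrib_right
    by (rule sum.cong[OF refl], subst sum.swap) (simp add: mult_ac)
  finally show ?thesis .
qed

lemma bform_spec_self:
  "bform d f (spec_mat d e x) f = complex_of_real (\<Sum>r<d. x r * (cmod (cip d (e r) f))\<^sup>2)"
  unfolding bform_spec of_real_sum of_real_mult complex_norm_square
  by (simp add: cnj_cip mult_ac)

lemma bform_spec_basis:
  assumes "onb d e" "r < d"
  shows "bform d (e r) (spec_mat d e x) g = complex_of_real (x r) * cip d (e r) g"
    and "bform d g (spec_mat d e x) (e r) = complex_of_real (x r) * cip d g (e r)"
proof -
  have "bform d (e r) (spec_mat d e x) g
      = (\<Sum>s<d. if s = r then complex_of_real (x r) * cip d (e r) g else 0)"
    unfolding bform_spec using assms by (intro sum.cong) (auto simp: onb_cip)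
  then show "bform d (e r) (spec_mat d e x) g = complex_of_real (x r) * cip d (e r) g"
    using assms(2) by simp
  have "bform d g (spec_mat d e x) (e r)
      = (\<Sum>s<d. if s = r then complex_of_real (x r) * cip d g (e r) else 0)"
    unfolding bform_spec using assms by (intro sum.cong) (auto simp: onb_cip)
  then show "bform d g (spec_mat d e x) (e r) = complex_of_real (x r) * cip d g (e r)"
    using assms(2) by simp
qed

text \<open>If an eigenvector of one diagonalisation overlaps an eigenvector of the other, their
  eigenvalues agree. Hence f(x r) may be exchanged for f(x' s) next to every overlap, after
  expanding one basis in the other.\<close>

lemma spec_mat_fun_cong:
  assumes e: "onb d e" and e': "onb d e'" and eq: "spec_mat d e x = spec_mat d e' x'"
  shows "spec_mat d e (\<lambda>r. f (x r)) = spec_mat d e' (\<lambda>r. f (x' r))"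
proof (rule eq_matI)
  fix i j assume "i < dim_row (spec_mat d e' (\<lambda>r. f (x' r)))" "j < dim_col (spec_mat d e' (\<lambda>r. f (x' r)))"
  then have ij: "i < d" "j < d" by auto
  \<comment> \<open>Evaluating the common matrix between \<open>e r\<close> and \<open>e' s\<close>
    through both decompositions gives (x r - x' s) times the overlap = 0.\<close>
  have c: "complex_of_real (f (x r)) * cip d (e r) (e' s) = complex_of_real (f (x' s)) * cip d (e r) (e' s)"
    if "r < d" "s < d" for r s
  proof -
    have "complex_of_real (x r) * cip d (e r) (e' s) = complex_of_real (x' s) * cip d (e r) (e' s)"
      using bform_spec_basis(1)[OF e that(1), of x "e' s"] bform_spec_basis(2)[OF e' that(2), of "e r" x']
      unfolding eq by metis
    then have "cip d (e r) (e' s) = 0 \<or> x r = x' s" by (metis mult_right_cancel of_real_eq_iff)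
    then show ?thesis by auto
  qed
  have "spec_mat d e (\<lambda>r. f (x r)) $$ (i, j) = (\<Sum>r<d. complex_of_real (f (x r)) * e r i *
      (\<Sum>s<d. cip d (e r) (e' s) * cnj (e' s j)))"
    using ij by (simp add: onb_expansion_cnj[OF e'])
  also have "\<dots> = (\<Sum>r<d. \<Sum>s<d. (complex_of_real (f (x r)) * cip d (e r) (e' s)) * e r i * cnj (e' s j))"
    by (simp add: sum_distrib_left mult_ac)
  also have "\<dots> = (\<Sum>r<d. \<Sum>s<d. complex_of_real (f (x' s)) * cnj (e' s j) * (cip d (e r) (e' s) * e r i))"
    by (intro sum.cong refl) (simp add: c)
  also have "\<dots> = (\<Sum>s<d. complex_of_real (f (x' s)) * cnj (e' s j) * (\<Sum>r<d. cip d (e r) (e' s) * e r i))"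
    by (subst sum.swap) (simp add: sum_distrib_left)
  also have "\<dots> = spec_mat d e' (\<lambda>r. f (x' r)) $$ (i, j)"
    unfolding spec_mat_index[OF ij] onb_expansion[OF e ij(1)] by (simp add: mult_ac)
  finally show "spec_mat d e (\<lambda>r. f (x r)) $$ (i, j) = spec_mat d e' (\<lambda>r. f (x' r)) $$ (i, j)" .
qed auto

lemma onb_of_unitary:
  assumes "U \<in> carrier_mat d d" "unitary U"
  shows "onb d (\<lambda>r i. U $$ (i, r))"
proof -
  have 1: "mat_adjoint U * U = 1\<^sub>m d" and 2: "U * mat_adjoint U = 1\<^sub>m d"
    using assms by (auto simp: unitary_def)
  have "(\<Sum>i<d. cnj (U $$ (i, r)) * U $$ (i, s)) = (if r = s then 1 else 0)" if "r < d" "s < d" for r s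
    using arg_cong[OF 1, of "\<lambda>M. M $$ (r, s)"] assms(1) that
    by (simp add: scalar_prod_def atLeast0LessThan)
  moreover have "(\<Sum>r<d. U $$ (i, r) * cnj (U $$ (j, r))) = (if i = j then 1 else 0)"
    if "i < d" "j < d" for i j
    using arg_cong[OF 2, of "\<lambda>M. M $$ (i, j)"] assms(1) that
    by (simp add: scalar_prod_def atLeast0LessThan)
  ultimately show ?thesis by (simp add: onb_def cip_def)
qed

lemma unitary_of_onb:
  assumes "onb d e"
  shows "unitary (mat d d (\<lambda>(i, r). e r i))"
  by (rule unitaryI[of _ d], simp, rule eq_matI)
    (use assms in \<open>auto simp: scalar_prod_def onb_def cip_def atLeast0LessThan\<close>)

lemma conjugated_diagonal_eq_spec_mat:
  assumes "U \<in> carrier_mat d d"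
  shows "U * mat_diag d (\<lambda>i. complex_of_real (x i)) * mat_adjoint U = spec_mat d (\<lambda>r i. U $$ (i, r)) x"
proof (rule eq_matI)
  fix i j assume "i < dim_row (spec_mat d (\<lambda>r i. U $$ (i, r)) x)" "j < dim_col (spec_mat d (\<lambda>r i. U $$ (i, r)) x)"
  then have ij: "i < d" "j < d" by auto
  have "(U * mat_diag d (\<lambda>i. complex_of_real (x i))) $$ (i, r) = U $$ (i, r) * complex_of_real (x r)"
    if "r < d" for r
    using that ij assms by (simp add: mat_diag_mult_right)
  then show "(U * mat_diag d (\<lambda>i. complex_of_real (x i)) * mat_adjoint U) $$ (i, j)
      = spec_mat d (\<lambda>r i. U $$ (i, r)) x $$ (i, j)"
    using ij assms by (simp add: scalar_prod_def atLeast0LessThan mult_ac mat_diag_mult_right)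
qed (use assms in auto)

lemma hermitian_eq_spec_mat:
  assumes "X \<in> carrier_mat d d" "hermitian X"
  obtains e x where "onb d e" "X = spec_mat d e x"
  using spectral_decomposition[OF assms] onb_of_unitary conjugated_diagonal_eq_spec_mat by metis

text \<open>Discharges the definite description: the unitary with columns \<open>e r\<close> is a
  witness, and \<open>spec_mat_fun_cong\<close> gives uniqueness. Functional calculus then just acts
  on eigenvalues.\<close>

lemma hermitian_fun_spec_mat:
  assumes e: "onb d e"
  shows "hermitian_fun f (spec_mat d e x) = spec_mat d e (\<lambda>r. f (x r))"
  unfolding hermitian_fun_def spec_mat_dim
proof (rule the_equality)
  let ?U = "mat d d (\<lambda>(i, r). e r i)"
  have eq: "spec_mat d (\<lambda>r i. ?U $$ (i, r)) y = spec_mat d e y" for y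
    by (rule eq_matI) auto
  show "\<exists>U y. U \<in> carrier_mat d d \<and> unitary U \<and>
      spec_mat d e x = U * mat_diag d (\<lambda>i. complex_of_real (y i)) * mat_adjoint U \<and>
      spec_mat d e (\<lambda>r. f (x r)) = U * mat_diag d (\<lambda>i. complex_of_real (f (y i))) * mat_adjoint U"
    using unitary_of_onb[OF e] conjugated_diagonal_eq_spec_mat[of ?U d] eq
    by (intro exI[of _ ?U] exI[of _ x]) auto
next
  fix M assume "\<exists>U y. U \<in> carrier_mat d d \<and> unitary U \<and>
      spec_mat d e x = U * mat_diag d (\<lambda>i. complex_of_real (y i)) * mat_adjoint U \<and>
      M = U * mat_diag d (\<lambda>i. complex_of_real (f (y i))) * mat_adjoint U"
  then obtain U y where U: "U \<in> carrier_mat d d" "unitary U"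
    and "spec_mat d e x = spec_mat d (\<lambda>r i. U $$ (i, r)) y"
    and M: "M = spec_mat d (\<lambda>r i. U $$ (i, r)) (\<lambda>r. f (y r))"
    using conjugated_diagonal_eq_spec_mat by metis
  then show "M = spec_mat d e (\<lambda>r. f (x r))"
    using spec_mat_fun_cong[OF e onb_of_unitary[OF U]] by metis
qed

lemma spec_mat_trace:
  assumes "onb d e"
  shows "mat_trace (spec_mat d e x) = complex_of_real (\<Sum>r<d. x r)"
proof -
  have "mat_trace (spec_mat d e x) = (\<Sum>i<d. \<Sum>r<d. complex_of_real (x r) * (cnj (e r i) * e r i))"
    by (simp add: mat_trace_def mult_ac)
  also have "\<dots> = (\<Sum>r<d. complex_of_real (x r) * cip d (e r) (e r))"
    by (subst sum.swap) (simp add: cip_def sum_distrib_left)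
  also have "\<dots> = (\<Sum>r<d. complex_of_real (x r))"
    using assms by (intro sum.cong) (auto simp: onb_cip)
  finally show ?thesis by simp
qed

lemma spec_mat_mult:
  assumes "onb d e"
  shows "spec_mat d e x * spec_mat d e y = spec_mat d e (\<lambda>r. x r * y r)"
proof (rule eq_matI)
  fix i j assume "i < dim_row (spec_mat d e (\<lambda>r. x r * y r))" "j < dim_col (spec_mat d e (\<lambda>r. x r * y r))"
  then have ij: "i < d" "j < d" by auto
  have "(spec_mat d e x * spec_mat d e y) $$ (i, j)
      = (\<Sum>k<d. (\<Sum>r<d. complex_of_real (x r) * e r i * cnj (e r k)) *
          (\<Sum>s<d. complex_of_real (y s) * e s k * cnj (e s j)))"
    using ij by (simp add: scalar_prod_def atLeast0LessThan)
  also have "\<dots> = (\<Sum>k<d. \<Sum>r<d. complex_of_real (x r) * e r i *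
      (cnj (e r k) * (\<Sum>s<d. complex_of_real (y s) * e s k * cnj (e s j))))"
    by (simp add: sum_distrib_right mult.assoc)
  also have "\<dots> = (\<Sum>r<d. complex_of_real (x r) * e r i *
      (\<Sum>k<d. \<Sum>s<d. complex_of_real (y s) * cnj (e s j) * (cnj (e r k) * e s k)))"
    by (subst sum.swap) (simp add: sum_distrib_left mult_ac)
  also have "\<dots> = (\<Sum>r<d. complex_of_real (x r) * e r i *
      (\<Sum>s<d. complex_of_real (y s) * cnj (e s j) * cip d (e r) (e s)))"
    unfolding cip_def sum_distrib_left by (rule sum.cong[OF refl], rule sum.swap)
  also have "\<dots> = (\<Sum>r<d. complex_of_real (x r) * e r i *
      (\<Sum>s<d. if r = s then complex_of_real (y r) * cnj (e r j) else 0))"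
    using assms by (intro sum.cong refl arg_cong2[of _ _ _ _ "(*)"]) (auto simp: onb_cip)
  also have "\<dots> = spec_mat d e (\<lambda>r. x r * y r) $$ (i, j)"
    using ij by (simp add: mult_ac)
  finally show "(spec_mat d e x * spec_mat d e y) $$ (i, j) = spec_mat d e (\<lambda>r. x r * y r) $$ (i, j)" .
qed auto

lemma spec_mat_adjoint [simp]: "mat_adjoint (spec_mat d e x) = spec_mat d e x"
  by (rule eq_matI) (auto simp: mult_ac)

section \<open>Trace norm and entropy in terms of eigenvalues\<close>

lemma trace_norm_spec_mat:
  assumes "onb d e"
  shows "trace_norm (spec_mat d e x) = (\<Sum>r<d. \<bar>x r\<bar>)"
  unfolding trace_norm_def spec_mat_adjoint spec_mat_mult[OF assms] hermitian_fun_spec_mat[OF assms]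
    spec_mat_trace[OF assms]
  by simp

lemma von_neumann_entropy_spec_mat:
  assumes "onb d e"
  shows "von_neumann_entropy (spec_mat d e x) = - (\<Sum>r<d. x r * log 2 (x r))"
  unfolding von_neumann_entropy_def hermitian_fun_spec_mat[OF assms] spec_mat_mult[OF assms]
    spec_mat_trace[OF assms]
  by simp

text \<open>In an eigenbasis of X every weight |<e_r|f>|^2 is at most |f|^2. This compares the
  expectation of the projector onto f in two states that are close in trace norm.\<close>

lemma bform_le_trace_norm:
  assumes X: "X \<in> carrier_mat d d" "hermitian X"
  shows "cmod (bform d f X f) \<le> trace_norm X * nsq d f"
proof -
  obtain e x where e: "onb d e" and Xe: "X = spec_mat d e x" by (rule hermitian_eq_spec_mat[OF X])
  have "cmod (bform d f X f) = \<bar>\<Sum>r<d. x r * (cmod (cip d (e r) f))\<^sup>2\<bar>"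
    unfolding Xe bform_spec_self by (simp del: of_real_sum)
  also have "\<dots> \<le> (\<Sum>r<d. \<bar>x r\<bar> * (cmod (cip d (e r) f))\<^sup>2)"
    by (rule order_trans[OF sum_abs]) (simp add: abs_mult)
  also have "\<dots> \<le> (\<Sum>r<d. \<bar>x r\<bar> * nsq d f)"
  proof (intro sum_mono mult_left_mono)
    fix r assume "r \<in> {..<d}"
    then show "(cmod (cip d (e r) f))\<^sup>2 \<le> nsq d f"
      using cip_cauchy_schwarz[of d "e r" f] onb_nsq[OF e] by simp
  qed simp
  finally show ?thesis unfolding Xe trace_norm_spec_mat[OF e] by (simp add: sum_distrib_right)
qed

lemma bform_diff:
  assumes "X \<in> carrier_mat d d" "Y \<in> carrier_mat d d"
  shows "bform d f (X - Y) g = bform d f X g - bform d f Y g"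
  using assms by (simp add: bform_def algebra_simps sum_subtractf)

lemma bform_rank1: "bform d f (rank1 d g) f = complex_of_real ((cmod (cip d g f))\<^sup>2)"
proof -
  have "bform d f (rank1 d g) f = cip d f g * cip d g f"
    unfolding bform_def cip_def sum_product by (intro sum.cong refl) simp
  then show ?thesis by (simp add: complex_norm_square cnj_cip mult.commute del: of_real_power)
qed

lemma hermitian_diff:
  assumes "X \<in> carrier_mat d d" "Y \<in> carrier_mat d d" "hermitian X" "hermitian Y"
  shows "hermitian (X - Y)"
proof -
  have XY: "X - Y \<in> carrier_mat d d" using assms by auto
  have "(X - Y) $$ (j, i) = cnj ((X - Y) $$ (i, j))" if ij: "i < d" "j < d" for i j
  proof -
    have "X $$ (j, i) = cnj (X $$ (i, j))" "Y $$ (j, i) = cnj (Y $$ (i, j))"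
      using assms ij by (metis hermitian_index)+
    then show ?thesis using assms(1,2) ij by auto
  qed
  then show ?thesis unfolding hermitian_index[OF XY] by blast
qed

lemma hermitian_rank1: "hermitian (rank1 d f)"
  by (subst hermitian_index[of _ d]) auto

lemma cip_diff_right: "cip d e (\<lambda>i. f i - g i) = cip d e f - cip d e g"
  by (simp add: cip_def algebra_simps sum_subtractf)

text \<open>In an eigenbasis of the difference each eigenvalue is a_r^2 - b_r^2 = (a_r - b_r)(a_r +
  b_r), where a_r and b_r are the moduli of the coefficients of f and g, and |a_r - b_r| is at most
  the modulus of the coefficient of f - g. Cauchy-Schwarz and Parseval finish.\<close>

lemma trace_norm_rank1_diff:
  "trace_norm (rank1 d f - rank1 d g) \<le> sqrt (nsq d (\<lambda>i. f i - g i)) * (sqrt (nsq d f) + sqrt (nsq d g))"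
proof -
  let ?X = "rank1 d f - rank1 d g" and ?h = "\<lambda>i. f i - g i"
  have X: "?X \<in> carrier_mat d d" "hermitian ?X" by (auto intro: hermitian_diff[of _ d] hermitian_rank1)
  obtain e x where e: "onb d e" and Xe: "?X = spec_mat d e x" by (rule hermitian_eq_spec_mat[OF X])
  define a where "a r = cmod (cip d (e r) f)" for r
  define b where "b r = cmod (cip d (e r) g)" for r
  define c where "c r = cmod (cip d (e r) ?h)" for r
  have xr: "\<bar>x r\<bar> \<le> c r * (a r + b r)" if r: "r < d" for r
  proof -
    have "complex_of_real (x r) = bform d (e r) ?X (e r)"
      unfolding Xe bform_spec_basis[OF e r] using onb_cip[OF e r r] by simp
    also have "\<dots> = complex_of_real ((a r)\<^sup>2 - (b r)\<^sup>2)"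
      by (subst bform_diff) (auto simp: bform_rank1 a_def b_def cmod_cip_commute[of _ _ "e r"])
    finally have "x r = (a r - b r) * (a r + b r)"
      by (simp only: of_real_eq_iff) (simp add: power2_eq_square algebra_simps)
    moreover have "\<bar>a r - b r\<bar> \<le> c r"
      unfolding a_def b_def c_def cip_diff_right by (rule norm_triangle_ineq3)
    moreover have "0 \<le> a r + b r" by (simp add: a_def b_def)
    ultimately show ?thesis by (simp add: abs_mult mult_right_mono)
  qed
  have cs: "(\<Sum>r<d. u r * v r) \<le> sqrt (\<Sum>r<d. (u r)\<^sup>2) * sqrt (\<Sum>r<d. (v r)\<^sup>2)" for u v :: "nat \<Rightarrow> real"
    using order_trans[OF sum_mono L2_set_mult_ineq[of u v "{..<d}"], of "\<lambda>r. u r * v r"]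
    by (simp add: L2_set_def flip: abs_mult)
  have "trace_norm ?X \<le> (\<Sum>r<d. c r * (a r + b r))"
    unfolding Xe trace_norm_spec_mat[OF e] by (intro sum_mono xr) simp
  also have "\<dots> = (\<Sum>r<d. c r * a r) + (\<Sum>r<d. c r * b r)"
    by (simp add: algebra_simps sum.distrib)
  also have "\<dots> \<le> sqrt (nsq d ?h) * sqrt (nsq d f) + sqrt (nsq d ?h) * sqrt (nsq d g)"
    using cs[of c a] cs[of c b] unfolding a_def b_def c_def parseval[OF e] by (rule add_mono)
  finally show ?thesis by (simp add: algebra_simps)
qed

lemma quadratic_form_eq_bform:
  assumes "X \<in> carrier_mat d d" "v \<in> carrier_vec d"
  shows "(X *\<^sub>v v) \<bullet>c v = bform d (\<lambda>i. v $ i) X (\<lambda>i. v $ i)"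
  using assms
  by (auto simp: scalar_prod_def bform_def atLeast0LessThan sum_distrib_left sum_distrib_right mult_ac
      intro!: sum.cong)

text \<open>Positivity tested on the eigenvectors themselves yields nonnegative eigenvalues, and the
  trace condition makes them a probability distribution.\<close>

lemma density_operator_spec_mat:
  assumes "density_operator d \<rho>"
  obtains e x where "onb d e" "\<rho> = spec_mat d e x" "\<And>r. r < d \<Longrightarrow> 0 \<le> x r" "(\<Sum>r<d. x r) = 1"
proof -
  have \<rho>: "\<rho> \<in> carrier_mat d d" "hermitian \<rho>" "mat_trace \<rho> = 1"
    and psd: "\<And>v. v \<in> carrier_vec d \<Longrightarrow> 0 \<le> Re ((\<rho> *\<^sub>v v) \<bullet>c v)"
    using assms by (auto simp: density_operator_def positive_semidef_def)
  obtain e x where e: "onb d e" and eq: "\<rho> = spec_mat d e x" by (rule hermitian_eq_spec_mat[OF \<rho>(1,2)])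
  have "0 \<le> x r" if r: "r < d" for r
  proof -
    have "bform d (\<lambda>i. vec d (e r) $ i) \<rho> (\<lambda>i. vec d (e r) $ i) = bform d (e r) \<rho> (e r)"
      by (simp add: bform_def)
    also have "\<dots> = complex_of_real (x r)"
      unfolding eq bform_spec_basis[OF e r] using onb_cip[OF e r r] by simp
    finally show ?thesis
      using psd[of "vec d (e r)"] quadratic_form_eq_bform[OF \<rho>(1), of "vec d (e r)"] by simp
  qed
  moreover have "(\<Sum>r<d. x r) = 1"
    using \<rho>(3) unfolding eq spec_mat_trace[OF e] by (metis of_real_eq_1_iff)
  ultimately show thesis using that e eq by blast
qed

lemma density_operator_rank1:
  assumes "nsq d f = 1"
  shows "density_operator d (rank1 d f)"
proof -
  have "mat_trace (rank1 d f) = cip d f f"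
    by (simp add: mat_trace_def cip_def mult.commute)
  moreover have "0 \<le> Re ((rank1 d f *\<^sub>v v) \<bullet>c v)" if "v \<in> carrier_vec d" for v
    unfolding quadratic_form_eq_bform[OF rank1_carrier that] bform_rank1 by simp
  ultimately show ?thesis
    using assms hermitian_rank1 by (simp add: density_operator_def positive_semidef_def cip_self)
qed

section \<open>Decompositions into separable states\<close>

lemma sum_lessThan_add:
  fixes F :: "nat \<Rightarrow> 'a::comm_monoid_add"
  shows "(\<Sum>k<m + n. F k) = (\<Sum>k<m. F k) + (\<Sum>k<n. F (m + k))"
  by (induction n) (auto simp: add_ac)

text \<open>The one device for splitting composite indices: it separates A from B in a product
  index, and later the lowest letter from the rest of a word.\<close>

lemma sum_div_mod:
  fixes F :: "nat \<Rightarrow> nat \<Rightarrow> 'a::comm_monoid_add"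
  shows "(\<Sum>I<m * n. F (I div n) (I mod n)) = (\<Sum>a<m. \<Sum>b<n. F a b)"
proof (induction m)
  case (Suc m)
  have "(\<Sum>I<Suc m * n. F (I div n) (I mod n))
      = (\<Sum>I<m * n. F (I div n) (I mod n)) + (\<Sum>k<n. F ((m * n + k) div n) ((m * n + k) mod n))"
    using sum_lessThan_add[of "\<lambda>I. F (I div n) (I mod n)" "m * n" n] by (simp add: add.commute)
  also have "(\<Sum>k<n. F ((m * n + k) div n) ((m * n + k) mod n)) = (\<Sum>k<n. F m k)"
    by (intro sum.cong) auto
  finally show ?case using Suc.IH by simp
qed simp

definition tens :: "nat \<Rightarrow> (nat \<Rightarrow> complex) \<Rightarrow> (nat \<Rightarrow> complex) \<Rightarrow> nat \<Rightarrow> complex" where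
  "tens dB f g I = f (I div dB) * g (I mod dB)"

lemma cip_tens: "cip (dA * dB) (tens dB f g) (tens dB f' g') = cip dA f f' * cip dB g g'"
proof -
  have "cip (dA * dB) (tens dB f g) (tens dB f' g')
      = (\<Sum>a<dA. \<Sum>b<dB. cnj (f a * g b) * (f' a * g' b))"
    unfolding cip_def tens_def by (rule sum_div_mod)
  then show ?thesis unfolding cip_def sum_product by (simp add: mult_ac)
qed

lemma product_index:
  fixes I dA dB :: nat
  assumes "I < dA * dB"
  shows "I div dB < dA" "I mod dB < dB"
proof -
  show "I div dB < dA" using assms by (rule less_mult_imp_div_less)
  show "I mod dB < dB" using assms by (cases "dB = 0") auto
qed

lemma kron_rank1: "kron (rank1 dA f) (rank1 dB g) = rank1 (dA * dB) (tens dB f g)"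
proof (rule eq_matI, goal_cases)
  case (1 i j)
  then have ij: "i < dA * dB" "j < dA * dB" by auto
  show ?case using ij product_index[OF ij(1)] product_index[OF ij(2)] by (simp add: kron_def tens_def)
qed (auto simp: kron_def)

lemma rank1_tens_in_SEP:
  assumes "nsq dA f = 1" "nsq dB g = 1"
  shows "rank1 (dA * dB) (tens dB f g) \<in> SEP dA dB"
proof -
  have "rank1 (dA * dB) (tens dB f g) =
      real_lincomb (dA * dB) 1 (\<lambda>_. 1) (\<lambda>_. kron (rank1 dA f) (rank1 dB g))"
    by (rule eq_matI) (auto simp: real_lincomb_def kron_rank1)
  then show ?thesis
    unfolding SEP_def mem_Collect_eq
    using density_operator_rank1[OF assms(1)] density_operator_rank1[OF assms(2)]
    by - (rule exI[of _ "1 :: nat"], rule exI[of _ "\<lambda>_. 1"],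
        rule exI[of _ "\<lambda>_. rank1 dA f"], rule exI[of _ "\<lambda>_. rank1 dB g"], simp)
qed

definition sep_bound :: "nat \<Rightarrow> nat \<Rightarrow> complex mat \<Rightarrow> real \<Rightarrow> bool" where
  "sep_bound dA dB \<omega> c \<longleftrightarrow> (\<exists>m a \<tau>. (\<forall>i<m. \<tau> i \<in> SEP dA dB) \<and>
     \<omega> = real_lincomb (dA * dB) m a \<tau> \<and> (\<Sum>i<m. \<bar>a i\<bar>) \<le> c)"

lemma sep_bound_mono: "sep_bound dA dB \<omega> c \<Longrightarrow> c \<le> c' \<Longrightarrow> sep_bound dA dB \<omega> c'"
  unfolding sep_bound_def by (elim exE conjE, intro exI conjI, assumption+) linarith

lemma sep_bound_zero: "sep_bound dA dB (0\<^sub>m (dA * dB) (dA * dB)) 0"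
  unfolding sep_bound_def real_lincomb_def by (rule exI[of _ 0]) (auto intro!: eq_matI)

text \<open>Concatenation of the two decompositions, with the coefficients of the first scaled by
  t.\<close>

lemma sep_bound_axpy:
  assumes "sep_bound dA dB \<omega> c" "sep_bound dA dB \<omega>' c'"
  shows "sep_bound dA dB (mat (dA * dB) (dA * dB) (\<lambda>ij. complex_of_real t * \<omega> $$ ij + \<omega>' $$ ij))
    (\<bar>t\<bar> * c + c')"
proof -
  obtain m a \<tau> where 1: "\<forall>i<m. \<tau> i \<in> SEP dA dB" "\<omega> = real_lincomb (dA * dB) m a \<tau>" "(\<Sum>i<m. \<bar>a i\<bar>) \<le> c"
    using assms(1) unfolding sep_bound_def by blast
  obtain m' a' \<tau>' where 2: "\<forall>i<m'. \<tau>' i \<in> SEP dA dB" "\<omega>' = real_lincomb (dA * dB) m' a' \<tau>'"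
      "(\<Sum>i<m'. \<bar>a' i\<bar>) \<le> c'"
    using assms(2) unfolding sep_bound_def by blast
  define b where "b k = (if k < m then t * a k else a' (k - m))" for k
  define \<theta> where "\<theta> k = (if k < m then \<tau> k else \<tau>' (k - m))" for k
  have "(\<Sum>k<m + m'. \<bar>b k\<bar>) = \<bar>t\<bar> * (\<Sum>k<m. \<bar>a k\<bar>) + (\<Sum>k<m'. \<bar>a' k\<bar>)"
    unfolding sum_lessThan_add by (simp add: b_def sum_distrib_left abs_mult)
  also have "\<dots> \<le> \<bar>t\<bar> * c + c'" using 1(3) 2(3) by (intro add_mono mult_left_mono) auto
  finally have "(\<Sum>k<m + m'. \<bar>b k\<bar>) \<le> \<bar>t\<bar> * c + c'" .
  moreover have "mat (dA * dB) (dA * dB) (\<lambda>ij. complex_of_real t * \<omega> $$ ij + \<omega>' $$ ij)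
      = real_lincomb (dA * dB) (m + m') b \<theta>"
    unfolding 1(2) 2(2) real_lincomb_def sum_lessThan_add
    by (rule eq_matI) (auto simp: b_def \<theta>_def sum_distrib_left mult_ac)
  moreover have "\<forall>i<m + m'. \<theta> i \<in> SEP dA dB"
    using 1(1) 2(1) by (auto simp: \<theta>_def)
  ultimately show ?thesis unfolding sep_bound_def by blast
qed

lemma sep_bound_sum:
  assumes "finite K" "\<And>k. k \<in> K \<Longrightarrow> sep_bound dA dB (F k) (c k)"
    and "\<omega> \<in> carrier_mat (dA * dB) (dA * dB)"
    and "\<And>i j. i < dA * dB \<Longrightarrow> j < dA * dB \<Longrightarrow>
      \<omega> $$ (i, j) = (\<Sum>k\<in>K. complex_of_real (t k) * F k $$ (i, j))"
  shows "sep_bound dA dB \<omega> (\<Sum>k\<in>K. \<bar>t k\<bar> * c k)"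
proof -
  have "sep_bound dA dB (mat (dA * dB) (dA * dB) (\<lambda>ij. \<Sum>k\<in>K. complex_of_real (t k) * F k $$ ij))
      (\<Sum>k\<in>K. \<bar>t k\<bar> * c k)"
    using assms(1,2)
  proof (induction K)
    case empty
    have "mat (dA * dB) (dA * dB) (\<lambda>ij. 0 :: complex) = 0\<^sub>m (dA * dB) (dA * dB)" by (rule eq_matI) auto
    then show ?case using sep_bound_zero by simp
  next
    case (insert x K)
    have "mat (dA * dB) (dA * dB) (\<lambda>ij. \<Sum>k\<in>insert x K. complex_of_real (t k) * F k $$ ij)
       = mat (dA * dB) (dA * dB) (\<lambda>ij. complex_of_real (t x) * F x $$ ij
          + mat (dA * dB) (dA * dB) (\<lambda>ij. \<Sum>k\<in>K. complex_of_real (t k) * F k $$ ij) $$ ij)"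
      using insert.hyps by (intro eq_matI) auto
    then show ?case
      using sep_bound_axpy[of dA dB "F x" "c x" _ _ "t x"] insert by simp
  qed
  also have "mat (dA * dB) (dA * dB) (\<lambda>ij. \<Sum>k\<in>K. complex_of_real (t k) * F k $$ ij) = \<omega>"
    using assms(3,4) by (intro eq_matI) auto
  finally show ?thesis .
qed

lemma nsq_scale: "nsq d (\<lambda>i. c * f i) = (cmod c)\<^sup>2 * nsq d f"
  by (simp add: nsq_def norm_mult power_mult_distrib sum_distrib_left)

lemma nsq_zeroD: "nsq d f = 0 \<Longrightarrow> i < d \<Longrightarrow> f i = 0"
  unfolding nsq_def by (subst (asm) sum_nonneg_eq_0_iff) auto

text \<open>Normalising both factors gives a product state with the squared norms as coefficient. If
  a factor vanishes so does the operator; this case must be covered, since Schmidt vectors of weight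
  0 and superpositions such as f - f' may be zero.\<close>

lemma sep_bound_tens: "sep_bound dA dB (rank1 (dA * dB) (tens dB f g)) (nsq dA f * nsq dB g)"
proof (cases "nsq dA f * nsq dB g = 0")
  case True
  then have "tens dB f g I = 0" if "I < dA * dB" for I
    using product_index[OF that] nsq_zeroD by (auto simp: tens_def)
  then have "rank1 (dA * dB) (tens dB f g) = 0\<^sub>m (dA * dB) (dA * dB)"
    by (intro eq_matI) auto
  then show ?thesis using sep_bound_zero unfolding True by simp
next
  case False
  define f' where "f' i = complex_of_real (1 / sqrt (nsq dA f)) * f i" for i
  define g' where "g' i = complex_of_real (1 / sqrt (nsq dB g)) * g i" for i
  have "nsq dA f' = 1" "nsq dB g' = 1"
    unfolding f'_def g'_def nsq_scale using False by (auto simp: norm_divide power_divide)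
  then have "rank1 (dA * dB) (tens dB f' g') \<in> SEP dA dB" by (rule rank1_tens_in_SEP)
  moreover have "rank1 (dA * dB) (tens dB f g)
      = real_lincomb (dA * dB) 1 (\<lambda>_. nsq dA f * nsq dB g) (\<lambda>_. rank1 (dA * dB) (tens dB f' g'))"
  proof (rule eq_matI)
    let ?a = "complex_of_real (sqrt (nsq dA f))" and ?b = "complex_of_real (sqrt (nsq dB g))"
    have nz: "?a \<noteq> 0" "?b \<noteq> 0" using False by auto
    have sq: "complex_of_real (nsq dA f) = ?a * ?a" "complex_of_real (nsq dB g) = ?b * ?b"
      by (simp_all flip: of_real_mult)
    fix i j assume "i < dim_row (real_lincomb (dA * dB) 1 (\<lambda>_. nsq dA f * nsq dB g) (\<lambda>_. rank1 (dA * dB) (tens dB f' g')))"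
      "j < dim_col (real_lincomb (dA * dB) 1 (\<lambda>_. nsq dA f * nsq dB g) (\<lambda>_. rank1 (dA * dB) (tens dB f' g')))"
    then have ij: "i < dA * dB" "j < dA * dB" by (auto simp: real_lincomb_def)
    have "tens dB f g I = ?a * ?b * tens dB f' g' I" for I
      using nz by (simp add: tens_def f'_def g'_def)
    then show "rank1 (dA * dB) (tens dB f g) $$ (i, j)
      = real_lincomb (dA * dB) 1 (\<lambda>_. nsq dA f * nsq dB g) (\<lambda>_. rank1 (dA * dB) (tens dB f' g')) $$ (i, j)"
      using ij by (simp add: real_lincomb_def sq mult_ac)
  qed (auto simp: real_lincomb_def)
  ultimately show ?thesis
    unfolding sep_bound_def
    by (intro exI[of _ "1::nat"] exI[of _ "\<lambda>_. nsq dA f * nsq dB g"]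
        exI[of _ "\<lambda>_. rank1 (dA * dB) (tens dB f' g')"]) auto
qed

section \<open>Cost of coherences between product vectors\<close>

lemma nsq_add_le:
  assumes "cmod c = 1"
  shows "nsq d (\<lambda>i. f i + c * g i) \<le> 2 * (nsq d f + nsq d g)"
proof -
  have "(cmod (f i + c * g i))\<^sup>2 \<le> 2 * ((cmod (f i))\<^sup>2 + (cmod (g i))\<^sup>2)" for i
  proof -
    have "cmod (f i + c * g i) \<le> cmod (f i) + cmod (g i)"
      using norm_triangle_ineq[of "f i" "c * g i"] assms by (simp add: norm_mult)
    then have "(cmod (f i + c * g i))\<^sup>2 \<le> (cmod (f i) + cmod (g i))\<^sup>2" by (rule power_mono) simp
    also have "\<dots> \<le> 2 * ((cmod (f i))\<^sup>2 + (cmod (g i))\<^sup>2)"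
      using zero_le_power2[of "cmod (f i) - cmod (g i)"] by (simp add: power2_eq_square algebra_simps)
    finally show ?thesis .
  qed
  then have "nsq d (\<lambda>i. f i + c * g i) \<le> (\<Sum>i<d. 2 * ((cmod (f i))\<^sup>2 + (cmod (g i))\<^sup>2))"
    unfolding nsq_def by (intro sum_mono) auto
  then show ?thesis by (simp add: nsq_def sum.distrib sum_distrib_left)
qed

text \<open>The unprimed and primed a, b are values of f, f', g, g' at the row index, and c, d the
  conjugated values at the column index. The four summands belong to the phases 1, z, -1, -z; the
  primed letters a', d' carry the phase and b', c' its inverse, so exactly the monomials with
  balanced phases survive.\<close>

lemma polarization_identity:
  fixes a b c d a' b' c' d' z :: complex
  assumes "z * z = -1"
  shows "(a + a') * (b + b') * ((c + c') * (d + d'))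
      + (a + z * a') * (b - z * b') * ((c - z * c') * (d + z * d'))
      + (a - a') * (b - b') * ((c - c') * (d - d'))
      + (a - z * a') * (b + z * b') * ((c + z * c') * (d - z * d'))
    = 4 * ((a * b + a' * b') * (c * d + c' * d') + a' * b * (c' * d) + a * b' * (c * d'))"
proof -
  have "z * (z * x) = - x" for x using assms by (simp flip: mult.assoc)
  with assms show ?thesis by (simp add: algebra_simps)
qed

text \<open>The product vectors \<open>(f + s f') \<otimes> (g + s\<^sup>* g')\<close> with \<open>s\<^sup>4 = 1\<close> average to the coherent
  superposition of \<open>f \<otimes> g\<close> and \<open>f' \<otimes> g'\<close> plus an incoherent mixture of the two mixed products.\<close>

lemma sep_bound_cross:
  "sep_bound dA dB (mat (dA * dB) (dA * dB) (\<lambda>(I, J). tens dB f g I * cnj (tens dB f' g' J)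
      + tens dB f' g' I * cnj (tens dB f g J)))
    (5 * (nsq dA f + nsq dA f') * (nsq dB g + nsq dB g'))"
proof -
  let ?D = "dA * dB"
  define s where "s k = (\<i> :: complex) ^ k" for k :: nat
  define z where "z k = tens dB (\<lambda>a. f a + s k * f' a) (\<lambda>b. g b + cnj (s k) * g' b)" for k
  define N where "N k = nsq dA (\<lambda>a. f a + s k * f' a) * nsq dB (\<lambda>b. g b + cnj (s k) * g' b)" for k
  \<comment> \<open>The products whose projectors are subtracted: the two mixed ones that the
    averaging leaves behind, and the two diagonal ones, so that only the cross terms remain.\<close>
  define w where "w k = (if k = 0 then tens dB f g else if k = 1 then tens dB f g'
      else if k = 2 then tens dB f' g else tens dB f' g')" for k :: nat
  define M where "M k = (if k = 0 then nsq dA f * nsq dB g else if k = 1 then nsq dA f * nsq dB g'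
      else if k = 2 then nsq dA f' * nsq dB g else nsq dA f' * nsq dB g')" for k :: nat
  have s1: "cmod (s k) = 1" "cmod (cnj (s k)) = 1" for k by (simp_all add: s_def norm_power)
  \<comment> \<open>Superposing two vectors with a unit phase at most doubles the sum of their
    squared norms; doing so in both factors gives 4.\<close>
  have N: "N k \<le> 4 * (nsq dA f + nsq dA f') * (nsq dB g + nsq dB g')" for k
  proof -
    have "N k \<le> (2 * (nsq dA f + nsq dA f')) * (2 * (nsq dB g + nsq dB g'))"
      unfolding N_def by (intro mult_mono nsq_add_le s1) auto
    then show ?thesis by (simp add: algebra_simps)
  qed
  have M: "(\<Sum>k<4. M k) = (nsq dA f + nsq dA f') * (nsq dB g + nsq dB g')"
    by (simp add: M_def eval_nat_numeral algebra_simps)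
  have "sep_bound dA dB (mat ?D ?D (\<lambda>ij. \<Sum>k<4. complex_of_real (1 / 4) * rank1 ?D (z k) $$ ij))
      (\<Sum>k<4. \<bar>1 / 4\<bar> * N k)"
    by (rule sep_bound_sum[where F = "\<lambda>k. rank1 ?D (z k)"]) (auto simp: z_def N_def sep_bound_tens)
  moreover have "(\<Sum>k<4. \<bar>1 / 4\<bar> * N k) \<le> 4 * (nsq dA f + nsq dA f') * (nsq dB g + nsq dB g')"
    using N[of 0] N[of 1] N[of 2] N[of 3] by (simp add: eval_nat_numeral)
  ultimately have A: "sep_bound dA dB
      (mat ?D ?D (\<lambda>ij. \<Sum>k<4. complex_of_real (1 / 4) * rank1 ?D (z k) $$ ij))
      (4 * (nsq dA f + nsq dA f') * (nsq dB g + nsq dB g'))"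
    by (rule sep_bound_mono)
  have B: "sep_bound dA dB (mat ?D ?D (\<lambda>ij. \<Sum>k<4. complex_of_real 1 * rank1 ?D (w k) $$ ij))
      (\<Sum>k<4. \<bar>1\<bar> * M k)"
    by (rule sep_bound_sum[where F = "\<lambda>k. rank1 ?D (w k)"]) (auto simp: w_def M_def sep_bound_tens)
  have "mat ?D ?D (\<lambda>ij. complex_of_real (-1) * mat ?D ?D (\<lambda>ij. \<Sum>k<4. complex_of_real 1 * rank1 ?D (w k) $$ ij) $$ ij
      + mat ?D ?D (\<lambda>ij. \<Sum>k<4. complex_of_real (1 / 4) * rank1 ?D (z k) $$ ij) $$ ij)
    = mat ?D ?D (\<lambda>(I, J). tens dB f g I * cnj (tens dB f' g' J) + tens dB f' g' I * cnj (tens dB f g J))"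
  proof (rule eq_matI, goal_cases)
    case (1 I J)
    then have IJ: "I < ?D" "J < ?D" by auto
    define a a' b b' where abs: "a = f (I div dB)" "a' = f' (I div dB)" "b = g (I mod dB)" "b' = g' (I mod dB)"
    define c c' d d' where cds: "c = cnj (f (J div dB))" "c' = cnj (f' (J div dB))"
        "d = cnj (g (J mod dB))" "d' = cnj (g' (J mod dB))"
    have sk: "s 0 = 1" "s (Suc 0) = \<i>" "s (Suc (Suc 0)) = -1" "s (Suc (Suc (Suc 0))) = - \<i>"
      by (simp_all add: s_def)
    have "(\<Sum>k<4. rank1 ?D (z k) $$ (I, J)) = (a + a') * (b + b') * ((c + c') * (d + d'))
        + (a + \<i> * a') * (b - \<i> * b') * ((c - \<i> * c') * (d + \<i> * d'))
        + (a - a') * (b - b') * ((c - c') * (d - d'))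
        + (a - \<i> * a') * (b + \<i> * b') * ((c + \<i> * c') * (d - \<i> * d'))"
      using IJ by (simp add: eval_nat_numeral z_def tens_def sk abs cds)
    also have "\<dots> = 4 * ((a * b + a' * b') * (c * d + c' * d') + a' * b * (c' * d) + a * b' * (c * d'))"
      by (rule polarization_identity) simp
    finally have "(\<Sum>k<4. rank1 ?D (z k) $$ (I, J)) =
        4 * ((a * b + a' * b') * (c * d + c' * d') + a' * b * (c' * d) + a * b' * (c * d'))" .
    moreover have "(\<Sum>k<4. rank1 ?D (w k) $$ (I, J)) =
        a * b * (c * d) + a * b' * (c * d') + a' * b * (c' * d) + a' * b' * (c' * d')"
      using IJ by (simp add: eval_nat_numeral w_def tens_def abs cds)
    ultimately have "- (\<Sum>k<4. rank1 ?D (w k) $$ (I, J)) + 1 / 4 * (\<Sum>k<4. rank1 ?D (z k) $$ (I, J))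
        = a * b * (c' * d') + a' * b' * (c * d)"
      by (simp add: algebra_simps)
    moreover have "tens dB f g I * cnj (tens dB f' g' J) + tens dB f' g' I * cnj (tens dB f g J)
        = a * b * (c' * d') + a' * b' * (c * d)"
      by (simp add: tens_def abs cds)
    ultimately show ?case using IJ by (simp add: sum_distrib_left)
  qed auto
  \<comment> \<open>The constant 5 is 4 for the averaged superpositions plus 1 for the subtracted
    projectors, whose costs add up to exactly the product of the two sums.\<close>
  then show ?thesis
    using sep_bound_axpy[OF B A, of "-1"] unfolding M[symmetric]
    by (simp add: M algebra_simps)
qed

text \<open>Averaging the double sum with its transpose turns every summand into a Hermitian cross
  term. A single off-diagonal term is in general not Hermitian and then has no real decomposition
  into states.\<close>

lemma rank1_sum_index:
  fixes x :: "'i \<Rightarrow> nat \<Rightarrow> complex"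
  shows "(\<Sum>i\<in>T. x i I) * cnj (\<Sum>i\<in>T. x i J)
    = (\<Sum>(i, j)\<in>T \<times> T. complex_of_real (1 / 2) * (x i I * cnj (x j J) + x j I * cnj (x i J)))"
proof -
  have 1: "(\<Sum>i\<in>T. x i I) * cnj (\<Sum>i\<in>T. x i J) = (\<Sum>i\<in>T. \<Sum>j\<in>T. x i I * cnj (x j J))"
    by (simp add: sum_product)
  moreover have "\<dots> = (\<Sum>i\<in>T. \<Sum>j\<in>T. x j I * cnj (x i J))"
    by (rule sum.swap)
  ultimately have "(\<Sum>i\<in>T. x i I) * cnj (\<Sum>i\<in>T. x i J) =
      complex_of_real (1 / 2) * ((\<Sum>i\<in>T. \<Sum>j\<in>T. x i I * cnj (x j J)) + (\<Sum>i\<in>T. \<Sum>j\<in>T. x j I * cnj (x i J)))"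
    by simp
  also have "\<dots> = (\<Sum>(i, j)\<in>T \<times> T. complex_of_real (1 / 2) * (x i I * cnj (x j J) + x j I * cnj (x i J)))"
    by (simp add: sum.cartesian_product[symmetric] sum.distrib sum_distrib_left distrib_left)
  finally show ?thesis .
qed

text \<open>The norms on A being 1, the cross term of a pair (i, j) costs 5 * 2 * (|w_i|^2 +
  |w_j|^2). With the factor 1/2 from symmetrising, the sum over all pairs is linear in the number of
  terms.\<close>

lemma sep_bound_rank1_sum:
  fixes u w :: "'i \<Rightarrow> nat \<Rightarrow> complex"
  assumes T: "finite T" and u: "\<And>i. i \<in> T \<Longrightarrow> nsq dA (u i) = 1"
  shows "sep_bound dA dB (rank1 (dA * dB) (\<lambda>I. \<Sum>i\<in>T. tens dB (u i) (w i) I))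
    (10 * card T * (\<Sum>i\<in>T. nsq dB (w i)))"
proof -
  let ?D = "dA * dB"
  define x where "x i = tens dB (u i) (w i)" for i
  define F where "F = (\<lambda>(i, j). mat ?D ?D (\<lambda>(I, J). x i I * cnj (x j J) + x j I * cnj (x i J)))"
  define c where "c = (\<lambda>(i, j). 10 * (nsq dB (w i) + nsq dB (w j)))"
  have F: "sep_bound dA dB (F ij) (c ij)" if "ij \<in> T \<times> T" for ij
    using that u sep_bound_cross[of dA dB "u (fst ij)" "w (fst ij)" "u (snd ij)" "w (snd ij)"]
    by (auto simp: F_def c_def x_def)
  have "rank1 ?D (\<lambda>I. \<Sum>i\<in>T. x i I) $$ (I, J) = (\<Sum>ij\<in>T \<times> T. complex_of_real (1 / 2) * F ij $$ (I, J))"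
    if "I < ?D" "J < ?D" for I J
    unfolding rank1_index[OF that] rank1_sum_index
    by (rule sum.cong) (use that in \<open>auto simp: F_def\<close>)
  then have "sep_bound dA dB (rank1 ?D (\<lambda>I. \<Sum>i\<in>T. x i I)) (\<Sum>ij\<in>T \<times> T. \<bar>1 / 2\<bar> * c ij)"
    using T F by (intro sep_bound_sum[where F = F]) auto
  moreover have "(\<Sum>ij\<in>T \<times> T. \<bar>1 / 2\<bar> * c ij) = 10 * card T * (\<Sum>i\<in>T. nsq dB (w i))"
  proof -
    have "(\<Sum>ij\<in>T \<times> T. \<bar>1 / 2\<bar> * c ij) = (\<Sum>i\<in>T. \<Sum>j\<in>T. 5 * nsq dB (w i) + 5 * nsq dB (w j))"
      by (subst sum.cartesian_product) (auto simp: c_def intro!: sum.cong)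
    also have "\<dots> = 10 * card T * (\<Sum>i\<in>T. nsq dB (w i))"
      by (simp add: sum.distrib flip: sum_distrib_left)
    finally show ?thesis .
  qed
  ultimately show ?thesis by (simp add: x_def)
qed

text \<open>Slicing f along the standard basis of A writes any vector as a sum of products with unit
  vectors on A, so the preceding bound applies.\<close>

lemma sep_bound_rank1_exists: "\<exists>c. sep_bound dA dB (rank1 (dA * dB) f) c"
proof -
  let ?u = "\<lambda>i a. if a = i then 1 else 0 :: complex" and ?w = "\<lambda>i b. f (i * dB + b)"
  have "rank1 (dA * dB) f = rank1 (dA * dB) (\<lambda>I. \<Sum>i\<in>{..<dA}. tens dB (?u i) (?w i) I)"
  proof -
    have "(\<Sum>i<dA. tens dB (?u i) (?w i) I) = f I" if "I < dA * dB" for I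
    proof -
      have "(\<Sum>i<dA. tens dB (?u i) (?w i) I) = (\<Sum>i<dA. if I div dB = i then f I else 0)"
        by (intro sum.cong) (auto simp: tens_def)
      then show ?thesis using product_index[OF that] by simp
    qed
    then show ?thesis by (intro eq_matI) auto
  qed
  moreover have "nsq dA (?u i) = 1" if "i \<in> {..<dA}" for i
  proof -
    have "nsq dA (?u i) = (\<Sum>a<dA. if a = i then 1 else 0)"
      unfolding nsq_def by (intro sum.cong) auto
    then show ?thesis using that by simp
  qed
  ultimately show ?thesis
    using sep_bound_rank1_sum[of "{..<dA}" dA ?u dB ?w] by auto
qed

lemma sep_bound_hermitian_exists:
  assumes "X \<in> carrier_mat (dA * dB) (dA * dB)" "hermitian X"
  shows "\<exists>c. sep_bound dA dB X c"
proof -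
  obtain e x where X: "X = spec_mat (dA * dB) e x" by (rule hermitian_eq_spec_mat[OF assms])
  obtain c where c: "\<And>r. sep_bound dA dB (rank1 (dA * dB) (e r)) (c r)"
    using choice[of "\<lambda>r c. sep_bound dA dB (rank1 (dA * dB) (e r)) c"] sep_bound_rank1_exists by blast
  have "sep_bound dA dB X (\<Sum>r<dA * dB. \<bar>x r\<bar> * c r)"
    by (rule sep_bound_sum[where F = "\<lambda>r. rank1 (dA * dB) (e r)"]) (auto simp: c X mult_ac)
  then show ?thesis by blast
qed

section \<open>Passing between explicit decompositions and \<open>gamma_SEP\<close>\<close>

lemma SEP_nonempty:
  assumes "0 < dA" "0 < dB"
  shows "SEP dA dB \<noteq> {}"
proof -
  have "nsq d (\<lambda>i. if i = 0 then 1 else 0) = 1" if "0 < d" for d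
  proof -
    have "nsq d (\<lambda>i. if i = 0 then 1 else 0) = (\<Sum>a<d. if a = 0 then 1 else 0)"
      unfolding nsq_def by (intro sum.cong) auto
    then show ?thesis using that by simp
  qed
  then show ?thesis using rank1_tens_in_SEP assms by blast
qed

lemma sep_boundE:
  assumes "sep_bound dA dB \<omega> c" "0 < dA" "0 < dB"
  obtains m a \<tau> where "1 \<le> m" "\<forall>i<m. \<tau> i \<in> SEP dA dB" "\<omega> = real_lincomb (dA * dB) m a \<tau>"
    "(\<Sum>i<m. \<bar>a i\<bar>) \<le> c"
proof -
  obtain m a \<tau> where m: "\<forall>i<m. \<tau> i \<in> SEP dA dB" "\<omega> = real_lincomb (dA * dB) m a \<tau>" "(\<Sum>i<m. \<bar>a i\<bar>) \<le> c"
    using assms(1) unfolding sep_bound_def by blast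
  obtain \<tau>0 where "\<tau>0 \<in> SEP dA dB" using SEP_nonempty[OF assms(2,3)] by blast
  \<comment> \<open>One state with coefficient 0 is appended, so that the number of terms is at
    least 1 as \<open>gamma_SEP\<close> requires.\<close>
  define a' \<tau>' where "a' k = (if k < m then a k else 0)" and "\<tau>' k = (if k < m then \<tau> k else \<tau>0)" for k
  have "(\<Sum>i<Suc m. \<bar>a' i\<bar>) \<le> c" using m(3) by (simp add: a'_def)
  moreover have "\<omega> = real_lincomb (dA * dB) (Suc m) a' \<tau>'"
    unfolding m(2) real_lincomb_def by (simp add: a'_def \<tau>'_def)
  moreover have "\<forall>i<Suc m. \<tau>' i \<in> SEP dA dB" using m(1) \<open>\<tau>0 \<in> SEP dA dB\<close> by (auto simp: \<tau>'_def)
  ultimately show thesis using that[of "Suc m" \<tau>' a'] by simp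
qed

lemma gamma_SEP_le:
  assumes "sep_bound dA dB \<omega> c" "0 < dA" "0 < dB"
  shows "gamma_SEP dA dB \<omega> \<le> c"
proof -
  let ?S = "{\<Sum>i<m. \<bar>a i\<bar> | m a \<tau>. 1 \<le> m \<and> (\<forall>i<m. \<tau> i \<in> SEP dA dB) \<and> \<omega> = real_lincomb (dA * dB) m a \<tau>}"
  obtain m a \<tau> where m: "1 \<le> m" "\<forall>i<m. \<tau> i \<in> SEP dA dB" "\<omega> = real_lincomb (dA * dB) m a \<tau>"
    "(\<Sum>i<m. \<bar>a i\<bar>) \<le> c" by (rule sep_boundE[OF assms])
  have "(\<Sum>i<m. \<bar>a i\<bar>) \<in> ?S" using m(1-3) by blast
  moreover have "bdd_below ?S" by (rule bdd_belowI[of _ 0]) (auto intro: sum_nonneg)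
  ultimately show ?thesis unfolding gamma_SEP_def using m(4) by (meson cInf_lower order_trans)
qed

text \<open>The premise with a specific c makes the set of costs nonempty, the condition under which
  a lower bound on all costs passes to the real \<open>Inf\<close>.\<close>

lemma le_gamma_SEP:
  assumes "sep_bound dA dB \<omega> c" "0 < dA" "0 < dB" and L: "\<And>c. sep_bound dA dB \<omega> c \<Longrightarrow> L \<le> c"
  shows "L \<le> gamma_SEP dA dB \<omega>"
proof -
  let ?S = "{\<Sum>i<m. \<bar>a i\<bar> | m a \<tau>. 1 \<le> m \<and> (\<forall>i<m. \<tau> i \<in> SEP dA dB) \<and> \<omega> = real_lincomb (dA * dB) m a \<tau>}"
  obtain m a \<tau> where "1 \<le> m" "\<forall>i<m. \<tau> i \<in> SEP dA dB" "\<omega> = real_lincomb (dA * dB) m a \<tau>"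
    by (rule sep_boundE[OF assms(1-3)])
  then have "?S \<noteq> {}" by blast
  moreover have "L \<le> y" if y: "y \<in> ?S" for y
  proof -
    obtain m a \<tau> where "y = (\<Sum>i<m. \<bar>a i\<bar>)" "\<forall>i<m. \<tau> i \<in> SEP dA dB" "\<omega> = real_lincomb (dA * dB) m a \<tau>"
      using y by blast
    then show ?thesis unfolding sep_bound_def by (intro L[unfolded sep_bound_def]) blast
  qed
  ultimately show ?thesis unfolding gamma_SEP_def by (rule cInf_greatest)
qed

lemma gamma_SEP_nonneg: "0 < dA \<Longrightarrow> 0 < dB \<Longrightarrow> sep_bound dA dB \<omega> c \<Longrightarrow> 0 \<le> gamma_SEP dA dB \<omega>"
  by (rule le_gamma_SEP) (auto simp: sep_bound_def intro: order_trans[OF sum_nonneg])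

section \<open>Rank-one witnesses that bound the cost from below\<close>

lemma bform_sum:
  assumes "\<And>i j. i < d \<Longrightarrow> j < d \<Longrightarrow> X $$ (i, j) = (\<Sum>k\<in>K. complex_of_real (t k) * Y k $$ (i, j))"
  shows "bform d f X g = (\<Sum>k\<in>K. complex_of_real (t k) * bform d f (Y k) g)"
proof -
  have "bform d f X g = (\<Sum>i<d. \<Sum>j<d. \<Sum>k\<in>K. complex_of_real (t k) * (cnj (f i) * Y k $$ (i, j) * g j))"
    unfolding bform_def
    by (intro sum.cong refl) (auto simp: assms sum_distrib_left sum_distrib_right mult_ac intro!: sum.cong)
  also have "\<dots> = (\<Sum>i<d. \<Sum>k\<in>K. \<Sum>j<d. complex_of_real (t k) * (cnj (f i) * Y k $$ (i, j) * g j))"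
    by (rule sum.cong[OF refl], rule sum.swap)
  also have "\<dots> = (\<Sum>k\<in>K. \<Sum>i<d. \<Sum>j<d. complex_of_real (t k) * (cnj (f i) * Y k $$ (i, j) * g j))"
    by (rule sum.swap)
  finally show ?thesis by (simp add: bform_def sum_distrib_left)
qed

lemma cmod_convex_combination_le:
  assumes "\<And>k. k \<in> K \<Longrightarrow> 0 \<le> p k" "(\<Sum>k\<in>K. p k) = 1" "\<And>k. k \<in> K \<Longrightarrow> cmod (y k) \<le> l"
  shows "cmod (\<Sum>k\<in>K. complex_of_real (p k) * y k) \<le> l"
proof -
  have "cmod (\<Sum>k\<in>K. complex_of_real (p k) * y k) \<le> (\<Sum>k\<in>K. p k * l)"
    by (rule sum_norm_le) (use assms in \<open>auto simp: norm_mult intro!: mult_left_mono\<close>)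
  also have "\<dots> = l" using assms(2) by (simp flip: sum_distrib_right)
  finally show ?thesis .
qed

text \<open>Diagonalising both factors exhibits the product state as a convex combination of
  projectors onto product vectors of unit norm, for which the bound is the hypothesis on
  overlaps.\<close>

lemma bform_product_le:
  assumes l: "\<And>a b. (cmod (cip (dA * dB) f (tens dB a b)))\<^sup>2 \<le> l * nsq dA a * nsq dB b"
    and "density_operator dA \<alpha>" "density_operator dB \<beta>"
  shows "cmod (bform (dA * dB) f (kron \<alpha> \<beta>) f) \<le> l"
proof -
  obtain e x where \<alpha>: "onb dA e" "\<alpha> = spec_mat dA e x" "\<And>r. r < dA \<Longrightarrow> 0 \<le> x r" "(\<Sum>r<dA. x r) = 1"
    using density_operator_spec_mat[OF assms(2)] by blast
  obtain e' y where \<beta>: "onb dB e'" "\<beta> = spec_mat dB e' y" "\<And>r. r < dB \<Longrightarrow> 0 \<le> y r" "(\<Sum>r<dB. y r) = 1"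
    using density_operator_spec_mat[OF assms(3)] by blast
  let ?K = "{..<dA} \<times> {..<dB}"
  let ?t = "\<lambda>(r, s). x r * y s" and ?Y = "\<lambda>(r, s). rank1 (dA * dB) (tens dB (e r) (e' s))"
  have "bform (dA * dB) f (kron \<alpha> \<beta>) f = (\<Sum>k\<in>?K. complex_of_real (?t k) * bform (dA * dB) f (?Y k) f)"
  proof (rule bform_sum)
    fix i j assume ij: "i < dA * dB" "j < dA * dB"
    have "kron \<alpha> \<beta> $$ (i, j) = (\<Sum>r<dA. \<Sum>s<dB.
        (complex_of_real (x r) * e r (i div dB) * cnj (e r (j div dB))) *
        (complex_of_real (y s) * e' s (i mod dB) * cnj (e' s (j mod dB))))"
      using ij product_index[OF ij(1)] product_index[OF ij(2)]
      by (simp add: kron_def \<alpha>(2) \<beta>(2) sum_product)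
    also have "\<dots> = (\<Sum>k\<in>?K. complex_of_real (?t k) * ?Y k $$ (i, j))"
      unfolding sum.cartesian_product using ij by (intro sum.cong) (auto simp: tens_def)
    finally show "kron \<alpha> \<beta> $$ (i, j) = (\<Sum>k\<in>?K. complex_of_real (?t k) * ?Y k $$ (i, j))" .
  qed
  also have "cmod \<dots> \<le> l"
  proof (rule cmod_convex_combination_le)
    show "0 \<le> ?t k" if "k \<in> ?K" for k using that \<alpha>(3) \<beta>(3) by auto
    have "(\<Sum>k\<in>?K. ?t k) = (\<Sum>r<dA. x r) * (\<Sum>s<dB. y s)"
      by (simp add: sum_product sum.cartesian_product)
    then show "(\<Sum>k\<in>?K. ?t k) = 1" using \<alpha>(4) \<beta>(4) by simp
    show "cmod (bform (dA * dB) f (?Y k) f) \<le> l" if kK: "k \<in> ?K" for k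
    proof -
      obtain r s where k: "k = (r, s)" "r < dA" "s < dB" using kK by auto
      have "(cmod (cip (dA * dB) f (tens dB (e r) (e' s))))\<^sup>2 \<le> l"
        using l[of "e r" "e' s"] onb_nsq[OF \<alpha>(1) k(2)] onb_nsq[OF \<beta>(1) k(3)] by simp
      then show ?thesis unfolding k(1) by (simp add: bform_rank1 cmod_cip_commute[of _ _ f] del: of_real_power)
    qed
  qed
  finally show ?thesis .
qed

text \<open>Weak duality: the projector onto f has expectation at most l on every separable state,
  so any decomposition of \<omega> costs at least its expectation in \<omega> divided by l.\<close>

lemma bform_sep_bound_le:
  assumes l: "\<And>a b. (cmod (cip (dA * dB) f (tens dB a b)))\<^sup>2 \<le> l * nsq dA a * nsq dB b"
    and \<omega>: "sep_bound dA dB \<omega> c" and "0 \<le> l"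
  shows "cmod (bform (dA * dB) f \<omega> f) \<le> l * c"
proof -
  have SEP: "cmod (bform (dA * dB) f \<tau> f) \<le> l" if \<tau>: "\<tau> \<in> SEP dA dB" for \<tau>
  proof -
    obtain m p \<alpha> \<beta> where \<tau>: "\<tau> = real_lincomb (dA * dB) m p (\<lambda>k. kron (\<alpha> k) (\<beta> k))"
        "\<forall>k<m. 0 \<le> p k \<and> density_operator dA (\<alpha> k) \<and> density_operator dB (\<beta> k)" "(\<Sum>k<m. p k) = 1"
      using \<tau> unfolding SEP_def by blast
    have "bform (dA * dB) f \<tau> f = (\<Sum>k<m. complex_of_real (p k) * bform (dA * dB) f (kron (\<alpha> k) (\<beta> k)) f)"
      by (rule bform_sum) (simp add: \<tau>(1) real_lincomb_def)
    also have "cmod \<dots> \<le> l"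
      using \<tau>(2,3) by (intro cmod_convex_combination_le bform_product_le l) auto
    finally show ?thesis .
  qed
  obtain m a \<tau> where m: "\<forall>i<m. \<tau> i \<in> SEP dA dB" "\<omega> = real_lincomb (dA * dB) m a \<tau>" "(\<Sum>i<m. \<bar>a i\<bar>) \<le> c"
    using \<omega> unfolding sep_bound_def by blast
  have "bform (dA * dB) f \<omega> f = (\<Sum>k<m. complex_of_real (a k) * bform (dA * dB) f (\<tau> k) f)"
    by (rule bform_sum) (simp add: m(2) real_lincomb_def)
  also have "cmod \<dots> \<le> (\<Sum>k<m. \<bar>a k\<bar> * l)"
    by (rule sum_norm_le) (use m(1) SEP in \<open>auto simp: norm_mult intro!: mult_left_mono\<close>)
  also have "\<dots> = (\<Sum>k<m. \<bar>a k\<bar>) * l" by (simp add: sum_distrib_right)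
  also have "\<dots> \<le> l * c" using mult_right_mono[OF m(3) assms(3)] by (simp add: mult.commute)
  finally show ?thesis .
qed

section \<open>Typical sets\<close>

text \<open>Words of length n over d letters are coded as numbers below d^n, least significant
  letter first, in agreement with \<open>copy_index\<close>. Inductions on n peel off
  \<open>I mod d\<close>.\<close>

definition digit :: "nat \<Rightarrow> nat \<Rightarrow> nat \<Rightarrow> nat" where
  "digit d k I = I div d ^ k mod d"

lemma digit_0 [simp]: "digit d 0 I = I mod d"
  by (simp add: digit_def)

lemma digit_Suc [simp]: "digit d (Suc k) I = digit d k (I div d)"
  by (simp add: digit_def div_mult2_eq)

lemma digit_less: "0 < d \<Longrightarrow> digit d k I < d"
  by (simp add: digit_def)

lemma digit_inj:
  assumes "I < d ^ n" "J < d ^ n" "\<And>k. k < n \<Longrightarrow> digit d k I = digit d k J"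
  shows "I = J"
  using assms
proof (induction n arbitrary: I J)
  case (Suc n)
  have "I div d < d ^ n" "J div d < d ^ n"
    using Suc.prems(1,2) by (auto intro!: less_mult_imp_div_less simp: mult.commute)
  moreover have "digit d k (I div d) = digit d k (J div d)" if "k < n" for k
    using Suc.prems(3)[of "Suc k"] that by simp
  ultimately have "I div d = J div d" by (rule Suc.IH)
  moreover have "I mod d = J mod d" using Suc.prems(3)[of 0] by simp
  ultimately show ?case by (metis div_mult_mod_eq)
qed simp

text \<open>Distributivity, with the choice functions coded as numbers. The function g depends on
  the position k so that the induction can shift positions after removing the lowest letter.\<close>

lemma sum_prod_digits:
  fixes g :: "nat \<Rightarrow> nat \<Rightarrow> 'a::comm_semiring_1"
  shows "(\<Sum>I<d ^ n. \<Prod>k<n. g k (digit d k I)) = (\<Prod>k<n. \<Sum>r<d. g k r)"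
proof (induction n arbitrary: g)
  case (Suc n)
  have "(\<Sum>I<d ^ Suc n. \<Prod>k<Suc n. g k (digit d k I))
      = (\<Sum>I<d ^ n * d. (\<Prod>k<n. g (Suc k) (digit d k (I div d))) * g 0 (I mod d))"
    by (simp add: prod.lessThan_Suc_shift mult.commute del: prod.lessThan_Suc)
  also have "\<dots> = (\<Sum>q<d ^ n. \<Sum>r<d. (\<Prod>k<n. g (Suc k) (digit d k q)) * g 0 r)"
    by (rule sum_div_mod)
  also have "\<dots> = (\<Sum>q<d ^ n. \<Prod>k<n. g (Suc k) (digit d k q)) * (\<Sum>r<d. g 0 r)"
    by (simp add: sum_product)
  also have "\<dots> = (\<Prod>k<Suc n. \<Sum>r<d. g k r)"
    using Suc.IH[of "\<lambda>k. g (Suc k)"]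
    by (simp add: prod.lessThan_Suc_shift mult.commute del: prod.lessThan_Suc)
  finally show ?case .
qed simp

text \<open>Total mass and second moment of a sum of independent centred letters, as finite sums.
  Removing one letter splits the square, and the cross term vanishes because the mean does.\<close>

lemma iid_moments:
  fixes p Y :: "nat \<Rightarrow> real"
  assumes p: "(\<Sum>r<d. p r) = 1" and mean: "(\<Sum>r<d. p r * Y r) = 0"
  shows "(\<Sum>I<d ^ n. (\<Prod>k<n. p (digit d k I))) = 1"
    and "(\<Sum>I<d ^ n. (\<Prod>k<n. p (digit d k I)) * (\<Sum>k<n. Y (digit d k I))\<^sup>2)
      = n * (\<Sum>r<d. p r * (Y r)\<^sup>2)"
proof -
  define P where "P n I = (\<Prod>k<n. p (digit d k I))" for n I
  define S where "S n I = (\<Sum>k<n. Y (digit d k I))" for n I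
  have one: "(\<Sum>I<d ^ n. P n I) = 1" for n
    unfolding P_def using sum_prod_digits[of "\<lambda>_. p" d n] p by simp
  have P_Suc: "P (Suc n) I = P n (I div d) * p (I mod d)" for n I
    unfolding P_def by (simp add: prod.lessThan_Suc_shift mult.commute del: prod.lessThan_Suc)
  have S_Suc: "S (Suc n) I = S n (I div d) + Y (I mod d)" for n I
    unfolding S_def by (simp add: sum.lessThan_Suc_shift add.commute del: sum.lessThan_Suc)
  have two: "(\<Sum>I<d ^ n. P n I * S n I) = 0" for n
  proof (induction n)
    case (Suc n)
    have "(\<Sum>I<d ^ Suc n. P (Suc n) I * S (Suc n) I)
        = (\<Sum>I<d ^ n * d. (P n (I div d) * p (I mod d)) * (S n (I div d) + Y (I mod d)))"
      unfolding P_Suc S_Suc by (simp add: mult.commute)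
    also have "\<dots> = (\<Sum>q<d ^ n. \<Sum>r<d. (P n q * p r) * (S n q + Y r))"
      by (rule sum_div_mod)
    also have "\<dots> = (\<Sum>q<d ^ n. P n q * S n q * (\<Sum>r<d. p r) + P n q * (\<Sum>r<d. p r * Y r))"
      by (simp add: sum_distrib_left algebra_simps sum.distrib)
    also have "\<dots> = 0" unfolding p mean using Suc.IH by simp
    finally show ?case .
  qed (simp add: S_def)
  have three: "(\<Sum>I<d ^ n. P n I * (S n I)\<^sup>2) = n * (\<Sum>r<d. p r * (Y r)\<^sup>2)" for n
  proof (induction n)
    case (Suc n)
    have "(\<Sum>I<d ^ Suc n. P (Suc n) I * (S (Suc n) I)\<^sup>2)
        = (\<Sum>I<d ^ n * d. (P n (I div d) * p (I mod d)) * (S n (I div d) + Y (I mod d))\<^sup>2)"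
      unfolding P_Suc S_Suc by (simp add: mult.commute)
    also have "\<dots> = (\<Sum>q<d ^ n. \<Sum>r<d. (P n q * p r) * (S n q + Y r)\<^sup>2)"
      by (rule sum_div_mod)
    also have "\<dots> = (\<Sum>q<d ^ n. P n q * (S n q)\<^sup>2 * (\<Sum>r<d. p r)
        + 2 * (P n q * S n q) * (\<Sum>r<d. p r * Y r) + P n q * (\<Sum>r<d. p r * (Y r)\<^sup>2))"
      by (simp add: sum_distrib_left algebra_simps sum.distrib power2_eq_square)
    also have "\<dots> = n * (\<Sum>r<d. p r * (Y r)\<^sup>2) + (\<Sum>r<d. p r * (Y r)\<^sup>2)"
      unfolding p mean using Suc.IH one[of n] by (simp add: sum.distrib flip: sum_distrib_right)
    finally show ?case by (simp add: algebra_simps)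
  qed (simp add: S_def)
  show "(\<Sum>I<d ^ n. (\<Prod>k<n. p (digit d k I))) = 1"
    and "(\<Sum>I<d ^ n. (\<Prod>k<n. p (digit d k I)) * (\<Sum>k<n. Y (digit d k I))\<^sup>2)
      = n * (\<Sum>r<d. p r * (Y r)\<^sup>2)"
    using one three unfolding P_def S_def by auto
qed

definition typical :: "nat \<Rightarrow> (nat \<Rightarrow> real) \<Rightarrow> real \<Rightarrow> real \<Rightarrow> nat \<Rightarrow> nat set" where
  "typical d p H \<delta> n = {I. I < d ^ n \<and> 2 powr (- (n * (H + \<delta>))) \<le> (\<Prod>k<n. p (digit d k I)) \<and>
     (\<Prod>k<n. p (digit d k I)) \<le> 2 powr (- (n * (H - \<delta>)))}"

lemma finite_typical [simp]: "finite (typical d p H \<delta> n)"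
  unfolding typical_def by simp

text \<open>Chebyshev's inequality for the sum of the centred surprisals \<open>- log 2 (p r) - H\<close>.\<close>

lemma typical_weight:
  assumes p: "\<And>r. r < d \<Longrightarrow> 0 \<le> p r" "(\<Sum>r<d. p r) = 1"
    and H: "H = - (\<Sum>r<d. p r * log 2 (p r))" and \<delta>: "0 < \<delta>"
  obtains V where "0 \<le> V"
    "\<And>n. 0 < n \<Longrightarrow> 1 - V / n \<le> (\<Sum>I\<in>typical d p H \<delta> n. \<Prod>k<n. p (digit d k I))"
proof -
  define Y where "Y r = - log 2 (p r) - H" for r
  define V where "V = (\<Sum>r<d. p r * (Y r)\<^sup>2)"
  have d: "0 < d" using p(2) by (cases d) auto
  have mean: "(\<Sum>r<d. p r * Y r) = 0"
  proof -
    have "(\<Sum>r<d. p r * Y r) = - (\<Sum>r<d. p r * log 2 (p r)) - (\<Sum>r<d. p r) * H"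
      unfolding Y_def by (simp add: algebra_simps sum_subtractf sum_negf sum.distrib sum_distrib_left)
    then show ?thesis using p(2) H by simp
  qed
  have V: "0 \<le> V" unfolding V_def using p(1) by (intro sum_nonneg) auto
  have "1 - (V / \<delta>\<^sup>2) / n \<le> (\<Sum>I\<in>typical d p H \<delta> n. \<Prod>k<n. p (digit d k I))" if n: "0 < n" for n
  proof -
    define P where "P I = (\<Prod>k<n. p (digit d k I))" for I
    define S where "S I = (\<Sum>k<n. Y (digit d k I))" for I
    let ?T = "typical d p H \<delta> n"
    have P0: "0 \<le> P I" for I unfolding P_def using p(1) digit_less[OF d] by (intro prod_nonneg) auto
    \<comment> \<open>Markov's inequality pointwise. For a word of weight 0 it is trivial; otherwise
      all letters have positive probability, so the logarithm of the weight is a sum over letters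
      and leaving the typical range means |S I| \<ge> n \<delta>.\<close>
    have atypical: "P I \<le> P I * (S I)\<^sup>2 / (n * \<delta>)\<^sup>2" if I: "I \<in> {..<d ^ n} - ?T" for I
    proof (cases "P I = 0")
      case False
      then have pos: "0 < P I" using P0[of I] by simp
      have ppos: "p (digit d k I) > 0" if "k < n" for k
      proof -
        have "p (digit d k I) \<noteq> 0" using False that unfolding P_def by auto
        then show ?thesis using p(1)[OF digit_less[OF d, of k I]] by linarith
      qed
      then have "log 2 (P I) = (\<Sum>k<n. log 2 (p (digit d k I)))"
        unfolding P_def log_def by (subst ln_prod) (auto simp: sum_divide_distrib dest: ppos)
      then have S: "S I = - log 2 (P I) - n * H"
        by (simp add: S_def Y_def sum_subtractf sum_negf)
      have "P I < 2 powr (- (n * (H + \<delta>))) \<or> 2 powr (- (n * (H - \<delta>))) < P I"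
        using I unfolding typical_def P_def by auto
      then have "log 2 (P I) < - (n * (H + \<delta>)) \<or> - (n * (H - \<delta>)) < log 2 (P I)"
        using pos by (simp add: log_less_iff less_log_iff)
      then have "n * \<delta> \<le> \<bar>S I\<bar>" unfolding S by (auto simp: algebra_simps)
      then have "(n * \<delta>)\<^sup>2 \<le> (S I)\<^sup>2"
        using \<delta> by (metis abs_le_square_iff abs_of_nonneg mult_nonneg_nonneg of_nat_0_le_iff order_less_imp_le)
      then show ?thesis using pos \<delta> n by (simp add: field_simps)
    qed simp
    have "(\<Sum>I\<in>{..<d ^ n} - ?T. P I) \<le> (\<Sum>I\<in>{..<d ^ n} - ?T. P I * (S I)\<^sup>2 / (n * \<delta>)\<^sup>2)"
      by (intro sum_mono atypical)
    also have "\<dots> \<le> (\<Sum>I<d ^ n. P I * (S I)\<^sup>2 / (n * \<delta>)\<^sup>2)"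
      by (intro sum_mono2) (auto simp: P0)
    also have "\<dots> = (n * V) / (n * \<delta>)\<^sup>2"
      using iid_moments(2)[OF p(2) mean, of n] unfolding P_def S_def V_def
      by (simp flip: sum_divide_distrib)
    also have "\<dots> = (V / \<delta>\<^sup>2) / n" using n \<delta> by (simp add: field_simps power2_eq_square)
    finally have "(\<Sum>I\<in>{..<d ^ n} - ?T. P I) \<le> (V / \<delta>\<^sup>2) / n" .
    moreover have "(\<Sum>I\<in>{..<d ^ n} - ?T. P I) = 1 - (\<Sum>I\<in>?T. P I)"
      using iid_moments(1)[OF p(2) mean, of n] unfolding P_def
      by (subst sum_diff) (auto simp: typical_def)
    ultimately show ?thesis unfolding P_def by linarith
  qed
  \<comment> \<open>The constant is the variance of one letter divided by
    \<open>\<delta>\<^sup>2\<close>, independent of n.\<close>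
  then show thesis using that[of "V / \<delta>\<^sup>2"] V by simp
qed

text \<open>All words together have weight 1, and each typical word has at least the weight in the
  lower cut.\<close>

lemma card_typical_le:
  assumes p: "\<And>r. r < d \<Longrightarrow> 0 \<le> p r" "(\<Sum>r<d. p r) = 1"
  shows "card (typical d p H \<delta> n) \<le> 2 powr (n * (H + \<delta>))"
proof -
  let ?T = "typical d p H \<delta> n"
  have d: "0 < d" using p(2) by (cases d) auto
  have "card ?T * 2 powr (- (n * (H + \<delta>))) = (\<Sum>I\<in>?T. 2 powr (- (n * (H + \<delta>))))" by simp
  also have "\<dots> \<le> (\<Sum>I\<in>?T. \<Prod>k<n. p (digit d k I))"
    by (intro sum_mono) (auto simp: typical_def)
  also have "\<dots> \<le> (\<Sum>I<d ^ n. \<Prod>k<n. p (digit d k I))"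
    by (intro sum_mono2) (auto simp: typical_def intro!: prod_nonneg p(1) digit_less[OF d])
  also have "\<dots> = 1" using sum_prod_digits[of "\<lambda>_. p" d n] p(2) by simp
  finally show ?thesis unfolding powr_minus_divide by (simp add: divide_le_eq)
qed

section \<open>One-shot bounds\<close>

lemma cip_sum:
  "cip d (\<lambda>I. \<Sum>i\<in>S. x i I) (\<lambda>I. \<Sum>j\<in>T. y j I) = (\<Sum>i\<in>S. \<Sum>j\<in>T. cip d (x i) (y j))"
proof -
  have "cip d (\<lambda>I. \<Sum>i\<in>S. x i I) (\<lambda>I. \<Sum>j\<in>T. y j I) = (\<Sum>I<d. \<Sum>i\<in>S. \<Sum>j\<in>T. cnj (x i I) * y j I)"
    by (simp add: cip_def sum_product)
  also have "\<dots> = (\<Sum>i\<in>S. \<Sum>I<d. \<Sum>j\<in>T. cnj (x i I) * y j I)"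
    by (rule sum.swap)
  also have "\<dots> = (\<Sum>i\<in>S. \<Sum>j\<in>T. cip d (x i) (y j))"
    unfolding cip_def by (rule sum.cong[OF refl], rule sum.swap)
  finally show ?thesis .
qed

lemma cip_cong: "(\<And>i. i < d \<Longrightarrow> f i = f' i) \<Longrightarrow> (\<And>i. i < d \<Longrightarrow> g i = g' i) \<Longrightarrow> cip d f g = cip d f' g'"
  by (simp add: cip_def)

lemma cip_scale_left: "cip d (\<lambda>i. c * f i) g = cnj c * cip d f g"
  by (simp add: cip_def sum_distrib_left mult.assoc)

lemma cip_scale_right: "cip d f (\<lambda>i. c * g i) = c * cip d f g"
  by (simp add: cip_def sum_distrib_left mult_ac)

text \<open>Bessel's inequality for orthogonal vectors that are not normalised. With v = sum of c_i
  x_i, the overlap of v and b is S, the sum of the |c_i|^2, while |v|^2 \<le> l S; Cauchy-Schwarz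
  gives S^2 \<le> l S |b|^2, and S cancels.\<close>

lemma bessel:
  fixes x :: "'i \<Rightarrow> nat \<Rightarrow> complex"
  assumes T: "finite T"
    and orth: "\<And>i j. i \<in> T \<Longrightarrow> j \<in> T \<Longrightarrow> cip d (x i) (x j) = (if i = j then complex_of_real (p i) else 0)"
    and p: "\<And>i. i \<in> T \<Longrightarrow> p i \<le> l" "0 \<le> l"
  shows "(\<Sum>i\<in>T. (cmod (cip d (x i) b))\<^sup>2) \<le> l * nsq d b"
proof -
  define c where "c i = cip d (x i) b" for i
  define v where "v I = (\<Sum>i\<in>T. c i * x i I)" for I
  define S where "S = (\<Sum>i\<in>T. (cmod (c i))\<^sup>2)"
  have S0: "0 \<le> S" unfolding S_def by (simp add: sum_nonneg)
  \<comment> \<open>The sum over a one-point set gives b the shape expected by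
    \<open>cip_sum\<close>.\<close>
  have "cip d v b = cip d (\<lambda>I. \<Sum>i\<in>T. c i * x i I) (\<lambda>I. \<Sum>j\<in>{()}. b I)"
    unfolding v_def by simp
  also have "\<dots> = (\<Sum>i\<in>T. cnj (c i) * c i)"
    unfolding cip_sum by (simp add: cip_scale_left c_def)
  also have "\<dots> = complex_of_real S"
    unfolding S_def of_real_sum complex_norm_square by (simp add: mult.commute)
  finally have vb: "cip d v b = complex_of_real S" .
  have "cip d v v = (\<Sum>i\<in>T. \<Sum>j\<in>T. cnj (c i) * (c j * cip d (x i) (x j)))"
    unfolding v_def cip_sum by (simp add: cip_scale_left cip_scale_right)
  also have "\<dots> = (\<Sum>i\<in>T. \<Sum>j\<in>T. if i = j then complex_of_real (p i * (cmod (c i))\<^sup>2) else 0)"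
    by (intro sum.cong refl) (auto simp: orth complex_norm_square simp del: of_real_power)
  also have "\<dots> = (\<Sum>i\<in>T. complex_of_real (p i * (cmod (c i))\<^sup>2))"
    using T by (intro sum.cong) (auto simp: sum.delta')
  finally have "nsq d v = (\<Sum>i\<in>T. p i * (cmod (c i))\<^sup>2)"
    unfolding cip_self by (simp only: of_real_eq_iff flip: of_real_sum)
  also have "\<dots> \<le> l * S" unfolding S_def sum_distrib_left using p by (intro sum_mono mult_right_mono) auto
  finally have v: "nsq d v \<le> l * S" .
  have "S\<^sup>2 = (cmod (cip d v b))\<^sup>2" unfolding vb by (simp add: S0)
  also have "\<dots> \<le> nsq d v * nsq d b" by (rule cip_cauchy_schwarz)
  also have "\<dots> \<le> (l * S) * nsq d b" using v by (rule mult_right_mono) simp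
  finally have "S * S \<le> (l * nsq d b) * S" by (simp add: power2_eq_square mult_ac)
  then have "S \<le> l * nsq d b" using S0 p(2) by (cases "S = 0") auto
  then show ?thesis unfolding S_def c_def .
qed

text \<open>A Schmidt decomposition \<open>\<psi> = \<Sum>i<N. u i \<otimes> w i\<close>, with the Schmidt coefficients absorbed into
  \<open>w\<close>: the \<open>w i\<close> are orthogonal of squared norm \<open>p i\<close>, possibly zero.\<close>

locale schmidt =
  fixes dA dB N :: nat and u w :: "nat \<Rightarrow> nat \<Rightarrow> complex" and p :: "nat \<Rightarrow> real"
    and \<psi> :: "nat \<Rightarrow> complex"
  assumes dims: "0 < dA" "0 < dB"
    and u: "\<And>i j. i < N \<Longrightarrow> j < N \<Longrightarrow> cip dA (u i) (u j) = (if i = j then 1 else 0)"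
    and w: "\<And>i j. i < N \<Longrightarrow> j < N \<Longrightarrow> cip dB (w i) (w j) = (if i = j then complex_of_real (p i) else 0)"
    and \<psi>: "\<And>I. I < dA * dB \<Longrightarrow> \<psi> I = (\<Sum>i<N. tens dB (u i) (w i) I)"
    and p_sum: "(\<Sum>i<N. p i) = 1"
begin

text \<open>Deliberately unnormalised: its squared norm and its overlap with \<psi> are then the
  same number, the weight of T.\<close>

definition part :: "nat set \<Rightarrow> nat \<Rightarrow> complex" where
  "part T I = (\<Sum>i\<in>T. tens dB (u i) (w i) I)"

lemma p_eq_nsq: "i < N \<Longrightarrow> nsq dB (w i) = p i"
  using w[of i i] by (simp add: cip_self)

lemma p_nonneg: "i < N \<Longrightarrow> 0 \<le> p i"
  using p_eq_nsq[of i] nsq_nonneg[of dB "w i"] by simp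

lemma cip_part:
  assumes "S \<subseteq> {..<N}" "T \<subseteq> S"
  shows "cip (dA * dB) (part S) (part T) = complex_of_real (\<Sum>i\<in>T. p i)"
proof -
  have fin: "finite S" using assms(1) finite_subset by blast
  have "cip (dA * dB) (part S) (part T)
      = (\<Sum>i\<in>S. \<Sum>j\<in>T. cip dA (u i) (u j) * cip dB (w i) (w j))"
    unfolding part_def cip_sum cip_tens ..
  also have "\<dots> = (\<Sum>i\<in>S. \<Sum>j\<in>T. if i = j then complex_of_real (p j) else 0)"
    using assms by (intro sum.cong refl) (auto simp: u w subset_iff)
  also have "\<dots> = (\<Sum>j\<in>T. \<Sum>i\<in>S. if i = j then complex_of_real (p j) else 0)"
    by (rule sum.swap)
  also have "\<dots> = (\<Sum>j\<in>T. complex_of_real (p j))"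
    using assms fin by (intro sum.cong) (auto simp: subset_iff)
  finally show ?thesis by simp
qed

lemma nsq_part: "T \<subseteq> {..<N} \<Longrightarrow> nsq (dA * dB) (part T) = (\<Sum>i\<in>T. p i)"
  using cip_part[of T T] by (simp only: cip_self of_real_eq_iff order_refl)

lemma cip_psi_part: "T \<subseteq> {..<N} \<Longrightarrow> cip (dA * dB) \<psi> (part T) = complex_of_real (\<Sum>i\<in>T. p i)"
  using cip_part[of "{..<N}" T] cip_cong[of "dA * dB" \<psi> "part {..<N}" "part T" "part T"] \<psi>
  by (simp add: part_def)

lemma nsq_psi: "nsq (dA * dB) \<psi> = 1"
proof -
  have "nsq (dA * dB) \<psi> = nsq (dA * dB) (part {..<N})" by (simp add: nsq_def part_def \<psi>)
  then show ?thesis using nsq_part[of "{..<N}"] p_sum by simp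
qed

lemma weight_le_1:
  assumes "T \<subseteq> {..<N}"
  shows "(\<Sum>i\<in>T. p i) \<le> 1"
proof -
  have "(\<Sum>i\<in>T. p i) \<le> (\<Sum>i<N. p i)" using assms p_nonneg by (intro sum_mono2) auto
  then show ?thesis using p_sum by simp
qed

lemma smoothed_set_bdd_below:
  "bdd_below {gamma_SEP dA dB \<sigma> | \<sigma>. density_operator (dA * dB) \<sigma> \<and> P \<sigma>}"
proof (rule bdd_belowI[of _ 0])
  fix y assume "y \<in> {gamma_SEP dA dB \<sigma> | \<sigma>. density_operator (dA * dB) \<sigma> \<and> P \<sigma>}"
  then obtain \<sigma> where "y = gamma_SEP dA dB \<sigma>" "\<sigma> \<in> carrier_mat (dA * dB) (dA * dB)" "hermitian \<sigma>"
    by (auto simp: density_operator_def positive_semidef_def)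
  then show "0 \<le> y" using sep_bound_hermitian_exists gamma_SEP_nonneg dims by blast
qed

text \<open>The candidate is the normalised truncation g. Its overlap with \<psi> is sqrt q, so
  |\<psi> - g|^2 = 2 - 2 sqrt q; for unit vectors half the trace distance of the projectors is at
  most |\<psi> - g|.\<close>

lemma smoothed_gamma_le:
  assumes T: "T \<subseteq> {..<N}" and q: "q = (\<Sum>i\<in>T. p i)" "0 < q" and \<epsilon>: "sqrt (2 * (1 - q)) \<le> \<epsilon>"
  shows "smoothed_gamma_SEP dA dB \<epsilon> (rank1 (dA * dB) \<psi>) \<le> 10 * card T"
proof -
  let ?D = "dA * dB"
  have fin: "finite T" using T finite_subset by blast
  define s where "s = complex_of_real (1 / sqrt q)"
  define g where "g I = s * part T I" for I
  have s2: "(cmod s)\<^sup>2 = 1 / q" using q by (simp add: s_def norm_divide power_divide)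
  have g1: "nsq ?D g = 1" unfolding g_def nsq_scale s2 using nsq_part[OF T] q by simp
  have "cip ?D \<psi> g = s * complex_of_real q"
    unfolding g_def cip_scale_right cip_psi_part[OF T] q(1) ..
  also have "\<dots> = complex_of_real (sqrt q)"
    unfolding s_def using q(2) by (simp add: real_div_sqrt flip: of_real_divide of_real_mult)
  finally have \<psi>g: "cip ?D \<psi> g = complex_of_real (sqrt q)" .
  have "complex_of_real (nsq ?D (\<lambda>I. \<psi> I - g I)) = cip ?D \<psi> \<psi> - cip ?D \<psi> g - cnj (cip ?D \<psi> g) + cip ?D g g"
    unfolding cip_self[symmetric] cnj_cip by (simp add: cip_def algebra_simps sum_subtractf sum.distrib)
  also have "\<dots> = complex_of_real (2 - 2 * sqrt q)"
    unfolding \<psi>g unfolding cip_self nsq_psi g1 by simp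
  finally have "nsq ?D (\<lambda>I. \<psi> I - g I) = 2 - 2 * sqrt q" by (simp only: of_real_eq_iff)
  \<comment> \<open>From q \<le> sqrt q, valid because q \<le> 1.\<close>
  also have "\<dots> \<le> 2 * (1 - q)"
  proof -
    have "sqrt q \<le> 1" using weight_le_1[OF T] q by simp
    then have "sqrt q * sqrt q \<le> sqrt q * 1" using q(2) by (intro mult_left_mono) auto
    then show ?thesis using q(2) by simp
  qed
  finally have "sqrt (nsq ?D (\<lambda>I. \<psi> I - g I)) \<le> sqrt (2 * (1 - q))" by simp
  moreover have "trace_norm (rank1 ?D \<psi> - rank1 ?D g) \<le> 2 * sqrt (nsq ?D (\<lambda>I. \<psi> I - g I))"
    using trace_norm_rank1_diff[of ?D \<psi> g] unfolding nsq_psi g1 by simp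
  ultimately have "1 / 2 * trace_norm (rank1 ?D \<psi> - rank1 ?D g) \<le> \<epsilon>"
    using \<epsilon> by linarith
  then have "smoothed_gamma_SEP dA dB \<epsilon> (rank1 ?D \<psi>) \<le> gamma_SEP dA dB (rank1 ?D g)"
    unfolding smoothed_gamma_SEP_def using density_operator_rank1[OF g1]
    by (intro cInf_lower smoothed_set_bdd_below) blast
  also have "\<dots> \<le> 10 * card T"
  proof (rule gamma_SEP_le[OF _ dims])
    have nu: "nsq dA (u i) = 1" if "i \<in> T" for i
      using u[of i i] that T by (auto simp: cip_self)
    have "(\<Sum>i\<in>T. nsq dB (w i)) = q"
      unfolding q(1) using T by (intro sum.cong) (auto simp: p_eq_nsq)
    then have "sep_bound dA dB (rank1 ?D (part T)) (10 * card T * q)"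
      using sep_bound_rank1_sum[OF fin nu, where dB = dB and w = w] unfolding part_def by simp
    \<comment> \<open>Normalising multiplies the operator by 1 / q, which cancels the factor q in
      the cost. The one-point sum serves as plain rescaling.\<close>
    then have "sep_bound dA dB (rank1 ?D g) (\<Sum>k\<in>{()}. \<bar>1 / q\<bar> * (10 * card T * q))"
    proof (intro sep_bound_sum[where F = "\<lambda>_. rank1 ?D (part T)"])
      fix i j assume ij: "i < ?D" "j < ?D"
      have "s * cnj s = complex_of_real (1 / q)" unfolding s2[symmetric] complex_norm_square ..
      moreover have "rank1 ?D g $$ (i, j) = (s * cnj s) * rank1 ?D (part T) $$ (i, j)"
        using ij by (simp add: g_def)
      ultimately show "rank1 ?D g $$ (i, j) = (\<Sum>k\<in>{()}. complex_of_real (1 / q) * rank1 ?D (part T) $$ (i, j))"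
        by simp
    qed auto
    then show "sep_bound dA dB (rank1 ?D g) (10 * card T)" using q(2) by simp
  qed
  finally show ?thesis .
qed

text \<open>The overlap is the sum of <u_i|a><w_i|b>. Cauchy-Schwarz separates the factors; Bessel
  has constant 1 for the orthonormal \<open>u i\<close> and l for the \<open>w i\<close>.\<close>

lemma cip_part_tens_le:
  assumes T: "T \<subseteq> {..<N}" and l: "\<And>i. i \<in> T \<Longrightarrow> p i \<le> l" "0 \<le> l"
  shows "(cmod (cip (dA * dB) (part T) (tens dB a b)))\<^sup>2 \<le> l * nsq dA a * nsq dB b"
proof -
  have fin: "finite T" using T finite_subset by blast
  have "cip (dA * dB) (part T) (tens dB a b)
      = cip (dA * dB) (\<lambda>I. \<Sum>i\<in>T. tens dB (u i) (w i) I) (\<lambda>I. \<Sum>j\<in>{()}. tens dB a b I)"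
    unfolding part_def by simp
  also have "\<dots> = (\<Sum>i\<in>T. cip dA (u i) a * cip dB (w i) b)"
    unfolding cip_sum by (simp add: cip_tens)
  finally have "(cmod (cip (dA * dB) (part T) (tens dB a b)))\<^sup>2
      = (cmod (\<Sum>i\<in>T. cip dA (u i) a * cip dB (w i) b))\<^sup>2" by simp
  also have "\<dots> \<le> (\<Sum>i\<in>T. (cmod (cip dA (u i) a))\<^sup>2) * (\<Sum>i\<in>T. (cmod (cip dB (w i) b))\<^sup>2)"
    by (rule cmod_sum_mult_le)
  also have "\<dots> \<le> (1 * nsq dA a) * (l * nsq dB b)"
  proof (rule mult_mono)
    show "(\<Sum>i\<in>T. (cmod (cip dA (u i) a))\<^sup>2) \<le> 1 * nsq dA a"
      by (rule bessel[OF fin, where p = "\<lambda>_. 1"]) (use T u in \<open>auto simp: subset_iff\<close>)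
    show "(\<Sum>i\<in>T. (cmod (cip dB (w i) b))\<^sup>2) \<le> l * nsq dB b"
      by (rule bessel[OF fin, where p = p]) (use T w l in \<open>auto simp: subset_iff\<close>)
  qed (auto intro: sum_nonneg)
  finally show ?thesis by (simp add: mult_ac)
qed

lemma le_smoothed_gamma:
  assumes T: "T \<subseteq> {..<N}" and l: "\<And>i. i \<in> T \<Longrightarrow> p i \<le> l" "0 < l" and q: "q = (\<Sum>i\<in>T. p i)" and \<epsilon>: "0 \<le> \<epsilon>"
  shows "(q\<^sup>2 - 2 * \<epsilon>) / l \<le> smoothed_gamma_SEP dA dB \<epsilon> (rank1 (dA * dB) \<psi>)"
  unfolding smoothed_gamma_SEP_def
proof (rule cInf_greatest)
  let ?D = "dA * dB" and ?R = "rank1 (dA * dB) \<psi>"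
  \<comment> \<open>The state itself is admissible, so the infimum is over a nonempty set.\<close>
  have "trace_norm (?R - ?R) \<le> 0"
    using trace_norm_rank1_diff[of ?D \<psi> \<psi>] by (simp add: nsq_def)
  then have "density_operator ?D ?R \<and> 1 / 2 * trace_norm (?R - ?R) \<le> \<epsilon>"
    using density_operator_rank1[OF nsq_psi] \<epsilon> by simp
  then show "{gamma_SEP dA dB \<sigma> | \<sigma>. density_operator ?D \<sigma> \<and> 1 / 2 * trace_norm (?R - \<sigma>) \<le> \<epsilon>} \<noteq> {}"
    by blast
next
  let ?D = "dA * dB" and ?R = "rank1 (dA * dB) \<psi>" and ?f = "part T"
  fix y assume "y \<in> {gamma_SEP dA dB \<sigma> | \<sigma>. density_operator ?D \<sigma> \<and> 1 / 2 * trace_norm (?R - \<sigma>) \<le> \<epsilon>}"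
  then obtain \<sigma> where y: "y = gamma_SEP dA dB \<sigma>" and dens: "density_operator ?D \<sigma>"
    and dist: "trace_norm (?R - \<sigma>) \<le> 2 * \<epsilon>" by auto
  have \<sigma>: "\<sigma> \<in> carrier_mat ?D ?D" "hermitian \<sigma>"
    using dens by (auto simp: density_operator_def positive_semidef_def)
  have qf: "nsq ?D ?f = q" unfolding q by (rule nsq_part[OF T])
  have q01: "0 \<le> q" "q \<le> 1" using qf nsq_nonneg[of ?D ?f] weight_le_1[OF T] q by auto
  have "cmod (bform ?D ?f (?R - \<sigma>) ?f) \<le> trace_norm (?R - \<sigma>) * q"
    unfolding qf[symmetric] using \<sigma> by (intro bform_le_trace_norm) (auto intro!: hermitian_diff[of _ ?D] hermitian_rank1)
  \<comment> \<open>The 2 undoes the half in the trace distance; the squared norm q of the witness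
    is at most 1.\<close>
  also have "\<dots> \<le> (2 * \<epsilon>) * 1" using dist q01 \<epsilon> by (intro mult_mono) auto
  finally have 1: "cmod (bform ?D ?f ?R ?f - bform ?D ?f \<sigma> ?f) \<le> 2 * \<epsilon>"
    using \<sigma> by (simp add: bform_diff)
  have "bform ?D ?f ?R ?f = complex_of_real (q\<^sup>2)"
    unfolding bform_rank1 cip_psi_part[OF T] q[symmetric] using q01 by simp
  then have "cmod (bform ?D ?f ?R ?f) = q\<^sup>2" by (simp del: of_real_power)
  then have 2: "q\<^sup>2 - 2 * \<epsilon> \<le> cmod (bform ?D ?f \<sigma> ?f)"
    using 1 norm_triangle_ineq2[of "bform ?D ?f ?R ?f" "bform ?D ?f \<sigma> ?f"] by linarith
  obtain c where "sep_bound dA dB \<sigma> c" using sep_bound_hermitian_exists[OF \<sigma>] by blast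
  then show "(q\<^sup>2 - 2 * \<epsilon>) / l \<le> y" unfolding y
  proof (rule le_gamma_SEP[OF _ dims])
    fix c assume "sep_bound dA dB \<sigma> c"
    then have "cmod (bform ?D ?f \<sigma> ?f) \<le> l * c"
      using l(2) by (intro bform_sep_bound_le cip_part_tens_le[OF T l(1)]) auto
    then show "(q\<^sup>2 - 2 * \<epsilon>) / l \<le> c" using 2 l(2) by (simp add: field_simps)
  qed
qed

end

section \<open>Tensor powers and the limit\<close>

lemma copy_index_digit:
  "copy_index dA dB n k I = digit dA k (I div dB ^ n) * dB + digit dB k (I mod dB ^ n)"
  by (simp add: copy_index_def digit_def)

lemma copy_index_less:
  assumes "0 < dA" "0 < dB"
  shows "copy_index dA dB n k I < dA * dB"
proof -
  have "copy_index dA dB n k I < Suc (digit dA k (I div dB ^ n)) * dB"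
    unfolding copy_index_digit using digit_less[OF assms(2)] by simp
  also have "\<dots> \<le> dA * dB"
    using digit_less[OF assms(1), of k "I div dB ^ n"] by (intro mult_le_mono1) simp
  finally show ?thesis .
qed

lemma tensor_power_rank1:
  assumes "0 < dA" "0 < dB"
  shows "bipartite_tensor_power dA dB n (rank1 (dA * dB) \<psi>)
    = rank1 (dA ^ n * dB ^ n) (\<lambda>I. \<Prod>k<n. \<psi> (copy_index dA dB n k I))"
  by (rule eq_matI)
    (auto simp: bipartite_tensor_power_def copy_index_less[OF assms] prod.distrib)

text \<open>The product vector selected by a word I: its k-th tensor factor is \<open>u\<close> at
  the k-th letter of I. The word has base m, the coordinate a has base d.\<close>

definition tpow :: "nat \<Rightarrow> nat \<Rightarrow> nat \<Rightarrow> (nat \<Rightarrow> nat \<Rightarrow> complex) \<Rightarrow> nat \<Rightarrow> nat \<Rightarrow> complex" where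
  "tpow m d n u I a = (\<Prod>k<n. u (digit m k I) (digit d k a))"

lemma cip_tpow:
  "cip (d ^ n) (tpow m d n u I) (tpow m d n v J) = (\<Prod>k<n. cip d (u (digit m k I)) (v (digit m k J)))"
  using sum_prod_digits[of "\<lambda>k r. cnj (u (digit m k I) r) * v (digit m k J) r" d n]
  by (simp add: cip_def tpow_def prod.distrib)

lemma prod_digit_delta:
  fixes c :: "nat \<Rightarrow> 'a::comm_semiring_1"
  assumes "I < m ^ n" "J < m ^ n"
  shows "(\<Prod>k<n. if digit m k I = digit m k J then c (digit m k I) else 0)
    = (if I = J then \<Prod>k<n. c (digit m k I) else 0)"
proof (cases "I = J")
  case False
  then obtain k where "k < n" "digit m k I \<noteq> digit m k J" using digit_inj[OF assms] by blast
  then show ?thesis using False by (auto intro!: prod_zero)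
qed simp

text \<open>Inner products of product vectors factorise over the copies, so orthogonality survives
  and weights multiply. The product over copies of the Schmidt sums expands into a sum over words by
  \<open>sum_prod_digits\<close>. Interpreting the locale at the n-th power then makes the one-shot
  bounds available there.\<close>

lemma (in schmidt) schmidt_power:
  "schmidt (dA ^ n) (dB ^ n) (N ^ n) (tpow N dA n u) (tpow N dB n w)
    (\<lambda>I. \<Prod>k<n. p (digit N k I)) (\<lambda>I. \<Prod>k<n. \<psi> (copy_index dA dB n k I))"
proof
  have N: "0 < N" using p_sum by (cases N) auto
  note dl = digit_less[OF N]
  show "0 < dA ^ n" "0 < dB ^ n" using dims by auto
  show "(\<Sum>I<N ^ n. \<Prod>k<n. p (digit N k I)) = 1"
    using sum_prod_digits[of "\<lambda>_. p" N n] p_sum by simp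
next
  have N: "0 < N" using p_sum by (cases N) auto
  fix I J assume IJ: "I < N ^ n" "J < N ^ n"
  show "cip (dA ^ n) (tpow N dA n u I) (tpow N dA n u J) = (if I = J then 1 else 0)"
    unfolding cip_tpow u[OF digit_less[OF N] digit_less[OF N]] prod_digit_delta[OF IJ, of "\<lambda>_. 1"]
    by simp
  show "cip (dB ^ n) (tpow N dB n w I) (tpow N dB n w J)
      = (if I = J then complex_of_real (\<Prod>k<n. p (digit N k I)) else 0)"
    unfolding cip_tpow w[OF digit_less[OF N] digit_less[OF N]]
      prod_digit_delta[OF IJ, of "\<lambda>r. complex_of_real (p r)"]
    by simp
next
  fix I assume "I < dA ^ n * dB ^ n"
  have "\<psi> (copy_index dA dB n k I)
      = (\<Sum>i<N. u i (digit dA k (I div dB ^ n)) * w i (digit dB k (I mod dB ^ n)))" for k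
  proof -
    have "\<psi> (copy_index dA dB n k I) = (\<Sum>i<N. tens dB (u i) (w i) (copy_index dA dB n k I))"
      by (rule \<psi>) (rule copy_index_less[OF dims])
    then show ?thesis
      unfolding tens_def copy_index_digit using digit_less[OF dims(2)] dims(2) by simp
  qed
  then have "(\<Prod>k<n. \<psi> (copy_index dA dB n k I))
      = (\<Prod>k<n. \<Sum>i<N. u i (digit dA k (I div dB ^ n)) * w i (digit dB k (I mod dB ^ n)))" by simp
  also have "\<dots> = (\<Sum>J<N ^ n. tens (dB ^ n) (tpow N dA n u J) (tpow N dB n w J) I)"
    unfolding tens_def tpow_def prod.distrib[symmetric] by (rule sum_prod_digits[symmetric])
  finally show "(\<Prod>k<n. \<psi> (copy_index dA dB n k I))
      = (\<Sum>J<N ^ n. tens (dB ^ n) (tpow N dA n u J) (tpow N dB n w J) I)" .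
qed

section \<open>Exponential growth rates and the limits in n, \<delta> and \<epsilon>\<close>

lemma root_exponential_tendsto:
  assumes "0 < c"
  shows "(\<lambda>n. ereal (root n (c * 2 powr (real n * x)))) \<longlonglongrightarrow> ereal (2 powr x)"
proof -
  have "(\<lambda>n. root n c * 2 powr x) \<longlonglongrightarrow> 1 * 2 powr x"
    by (intro tendsto_mult LIMSEQ_root_const assms tendsto_const)
  moreover have "\<forall>\<^sub>F n in sequentially. root n c * 2 powr x = root n (c * 2 powr (real n * x))"
    using eventually_gt_at_top[of 0]
  proof eventually_elim
    case (elim n)
    have "2 powr (real n * x) = (2 powr x) ^ n" by (simp add: powr_power mult.commute)
    then show ?case using elim by (simp add: real_root_mult real_root_power_cancel)
  qed
  ultimately have "(\<lambda>n. root n (c * 2 powr (real n * x))) \<longlonglongrightarrow> 1 * 2 powr x"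
    by (rule Lim_transform_eventually)
  then show ?thesis by simp
qed

lemma liminf_root_ge:
  assumes c: "0 < c" and ev: "\<forall>\<^sub>F n in sequentially. c * 2 powr (real n * x) \<le> G n"
  shows "ereal (2 powr x) \<le> liminf (\<lambda>n. ereal (root n (G n)))"
proof -
  have "ereal (2 powr x) = liminf (\<lambda>n. ereal (root n (c * 2 powr (real n * x))))"
    using lim_imp_Liminf[OF sequentially_bot root_exponential_tendsto[OF c, of x]] by simp
  also have "\<dots> \<le> liminf (\<lambda>n. ereal (root n (G n)))"
    by (rule Liminf_mono, use ev eventually_gt_at_top[of 0] in eventually_elim)
      (simp add: real_root_le_mono)
  finally show ?thesis .
qed

lemma liminf_root_le:
  assumes c: "0 < c" and ev: "\<forall>\<^sub>F n in sequentially. G n \<le> c * 2 powr (real n * x)"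
  shows "liminf (\<lambda>n. ereal (root n (G n))) \<le> ereal (2 powr x)"
proof -
  have "liminf (\<lambda>n. ereal (root n (G n))) \<le> liminf (\<lambda>n. ereal (root n (c * 2 powr (real n * x))))"
    by (rule Liminf_mono, use ev eventually_gt_at_top[of 0] in eventually_elim)
      (simp add: real_root_le_mono)
  also have "\<dots> = ereal (2 powr x)"
    using lim_imp_Liminf[OF sequentially_bot root_exponential_tendsto[OF c, of x]] by simp
  finally show ?thesis .
qed

context schmidt
begin

abbreviation smoothed_power :: "real \<Rightarrow> nat \<Rightarrow> real" where
  "smoothed_power \<epsilon> n \<equiv> smoothed_gamma_SEP (dA ^ n) (dB ^ n) \<epsilon>
     (bipartite_tensor_power dA dB n (rank1 (dA * dB) \<psi>))"

lemma eventually_typical_weight: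
  assumes H: "H = - (\<Sum>r<N. p r * log 2 (p r))" and \<delta>: "0 < \<delta>" and c: "0 < c"
  shows "\<forall>\<^sub>F n in sequentially. 1 - c \<le> (\<Sum>I\<in>typical N p H \<delta> n. \<Prod>k<n. p (digit N k I))"
proof -
  obtain V where V: "0 \<le> V"
    "\<And>n. 0 < n \<Longrightarrow> 1 - V / n \<le> (\<Sum>I\<in>typical N p H \<delta> n. \<Prod>k<n. p (digit N k I))"
    using typical_weight[OF p_nonneg p_sum H \<delta>] by metis
  obtain m :: nat where m: "V / c < m" using reals_Archimedean2 by blast
  show ?thesis
    using eventually_ge_at_top[of m] eventually_gt_at_top[of 0]
  proof eventually_elim
    case (elim n)
    then have "V / c \<le> n" using m by linarith
    then have "V / n \<le> c" using elim c by (simp add: field_simps)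
    then show ?case using V(2)[of n] elim by linarith
  qed
qed

lemma eventually_smoothed_power_ge:
  assumes H: "H = - (\<Sum>r<N. p r * log 2 (p r))" and \<delta>: "0 < \<delta>" and \<epsilon>: "0 < \<epsilon>" "\<epsilon> < 1 / 4"
  shows "\<forall>\<^sub>F n in sequentially. 1 / 4 * 2 powr (real n * (H - \<delta>)) \<le> smoothed_power \<epsilon> n"
proof -
  \<comment> \<open>With q \<ge> 9/10 and 2 \<epsilon> < 1/2, the difference
    \<open>q\<^sup>2 - 2 * \<epsilon>\<close> exceeds 0.81 - 0.5, hence 1/4.\<close>
  have "\<forall>\<^sub>F n in sequentially. 1 - 1 / 10 \<le> (\<Sum>I\<in>typical N p H \<delta> n. \<Prod>k<n. p (digit N k I))"
    by (rule eventually_typical_weight[OF H \<delta>]) simp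
  then show ?thesis
  proof eventually_elim
    case (elim n)
    interpret n: schmidt "dA ^ n" "dB ^ n" "N ^ n" "tpow N dA n u" "tpow N dB n w"
      "\<lambda>I. \<Prod>k<n. p (digit N k I)" "\<lambda>I. \<Prod>k<n. \<psi> (copy_index dA dB n k I)"
      by (rule schmidt_power)
    define q where "q = (\<Sum>I\<in>typical N p H \<delta> n. \<Prod>k<n. p (digit N k I))"
    have q: "9 / 10 \<le> q" using elim unfolding q_def by simp
    then have "(9 / 10)\<^sup>2 \<le> q\<^sup>2" by (rule power_mono) simp
    then have "1 / 4 \<le> q\<^sup>2 - 2 * \<epsilon>" using \<epsilon> by (simp add: power2_eq_square)
    then have "1 / 4 * 2 powr (real n * (H - \<delta>)) \<le> (q\<^sup>2 - 2 * \<epsilon>) * 2 powr (real n * (H - \<delta>))"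
      by (rule mult_right_mono) simp
    also have "\<dots> = (q\<^sup>2 - 2 * \<epsilon>) / 2 powr (- (real n * (H - \<delta>)))"
      unfolding powr_minus_divide by simp
    also have "\<dots> \<le> smoothed_power \<epsilon> n"
      unfolding tensor_power_rank1[OF dims]
      by (rule n.le_smoothed_gamma[of "typical N p H \<delta> n"])
        (use \<epsilon> in \<open>auto simp: typical_def q_def\<close>)
    finally show ?case .
  qed
qed

lemma eventually_smoothed_power_le:
  assumes H: "H = - (\<Sum>r<N. p r * log 2 (p r))" and \<delta>: "0 < \<delta>" and \<epsilon>: "0 < \<epsilon>" "\<epsilon> < 1 / 4"
  shows "\<forall>\<^sub>F n in sequentially. smoothed_power \<epsilon> n \<le> 10 * 2 powr (real n * (H + \<delta>))"
proof -
  \<comment> \<open>The deficit is chosen so that sqrt (2 (1 - q)) \<le> \<epsilon>, the condition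
    of \<open>smoothed_gamma_le\<close>.\<close>
  have "\<forall>\<^sub>F n in sequentially. 1 - \<epsilon>\<^sup>2 / 2 \<le> (\<Sum>I\<in>typical N p H \<delta> n. \<Prod>k<n. p (digit N k I))"
    by (rule eventually_typical_weight[OF H \<delta>]) (use \<epsilon> in simp)
  then show ?thesis
  proof eventually_elim
    case (elim n)
    interpret n: schmidt "dA ^ n" "dB ^ n" "N ^ n" "tpow N dA n u" "tpow N dB n w"
      "\<lambda>I. \<Prod>k<n. p (digit N k I)" "\<lambda>I. \<Prod>k<n. \<psi> (copy_index dA dB n k I)"
      by (rule schmidt_power)
    define q where "q = (\<Sum>I\<in>typical N p H \<delta> n. \<Prod>k<n. p (digit N k I))"
    have q: "1 - \<epsilon>\<^sup>2 / 2 \<le> q" using elim unfolding q_def .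
    have "\<epsilon>\<^sup>2 < 1" using \<epsilon> by (simp add: power_less_one_iff)
    then have q0: "0 < q" using q by linarith
    have "sqrt (2 * (1 - q)) \<le> sqrt (\<epsilon>\<^sup>2)" using q by (intro real_sqrt_le_mono) (simp add: field_simps)
    then have "sqrt (2 * (1 - q)) \<le> \<epsilon>" using \<epsilon> by simp
    then have "smoothed_power \<epsilon> n \<le> 10 * card (typical N p H \<delta> n)"
      unfolding tensor_power_rank1[OF dims]
      by (intro n.smoothed_gamma_le[OF _ q_def q0]) (auto simp: typical_def)
    also have "\<dots> \<le> 10 * 2 powr (real n * (H + \<delta>))"
      using card_typical_le[OF p_nonneg p_sum, of H \<delta> n] by simp
    finally show ?case .
  qed
qed

text \<open>For fixed \<epsilon> the liminf lies between 2^(H - \<delta>) and 2^(H + \<delta>) for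
  every \<delta> > 0; letting \<delta> tend to 0 by continuity pins it down. Constancy near 0 also
  supplies the convergence that \<open>Lim\<close> presupposes.\<close>

lemma asymptotic_gamma_eq:
  assumes H: "H = - (\<Sum>r<N. p r * log 2 (p r))"
  shows "asymptotic_gamma_SEP dA dB (rank1 (dA * dB) \<psi>) = ereal (2 powr H)"
proof -
  define L where "L \<epsilon> = liminf (\<lambda>n. ereal (root n (smoothed_power \<epsilon> n)))" for \<epsilon>
  have L: "L \<epsilon> = ereal (2 powr H)" if \<epsilon>: "0 < \<epsilon>" "\<epsilon> < 1 / 4" for \<epsilon>
  proof (rule antisym)
    have 0: "((\<lambda>\<delta>. \<delta>) \<longlongrightarrow> 0) (at_right (0 :: real))" by (rule tendsto_ident_at)
    have "((\<lambda>\<delta>. ereal (2 powr (H + \<delta>))) \<longlongrightarrow> ereal (2 powr (H + 0))) (at_right 0)"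
      by (intro tendsto_intros 0) auto
    moreover have "\<forall>\<^sub>F \<delta> in at_right 0. L \<epsilon> \<le> ereal (2 powr (H + \<delta>))"
      using eventually_at_right_less
      by eventually_elim (auto simp: L_def intro!: liminf_root_le[of 10] eventually_smoothed_power_le[OF H _ \<epsilon>])
    ultimately have "L \<epsilon> \<le> ereal (2 powr (H + 0))"
      by (rule tendsto_lowerbound) (rule trivial_limit_at_right_real)
    then show "L \<epsilon> \<le> ereal (2 powr H)" by simp
    have "((\<lambda>\<delta>. ereal (2 powr (H - \<delta>))) \<longlongrightarrow> ereal (2 powr (H - 0))) (at_right 0)"
      by (intro tendsto_intros 0) auto
    moreover have "\<forall>\<^sub>F \<delta> in at_right 0. ereal (2 powr (H - \<delta>)) \<le> L \<epsilon>"
      using eventually_at_right_less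
      by eventually_elim
        (auto simp: L_def intro!: liminf_root_ge[of "1 / 4"] eventually_smoothed_power_ge[OF H _ \<epsilon>])
    ultimately have "ereal (2 powr (H - 0)) \<le> L \<epsilon>"
      by (rule tendsto_upperbound) (rule trivial_limit_at_right_real)
    then show "ereal (2 powr H) \<le> L \<epsilon>" by simp
  qed
  have "\<forall>\<^sub>F \<epsilon> in at_right 0. L \<epsilon> = ereal (2 powr H)"
    using eventually_at_right_real[of 0 "1 / 4"] by (auto elim!: eventually_mono intro: L)
  then have "(L \<longlongrightarrow> ereal (2 powr H)) (at_right 0)" by (rule tendsto_eventually)
  then show ?thesis
    unfolding asymptotic_gamma_SEP_def L_def[symmetric]
    by (intro tendsto_Lim trivial_limit_at_right_real)
qed

end

text \<open>All dA eigenvectors of the reduced state are kept; eigenvalue 0 simply gives a zero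
  vector on B. Taking the weights to be its eigenvalues is what later identifies their Shannon
  entropy with the von Neumann entropy.\<close>

lemma pure_state_schmidt:
  assumes pure: "pure_state (dA * dB) \<rho>"
  obtains u w p \<psi> where "schmidt dA dB dA u w p \<psi>" "\<rho> = rank1 (dA * dB) \<psi>"
    "onb dA u" "partial_trace_B dA dB \<rho> = spec_mat dA u p"
proof -
  obtain v where v: "v \<in> carrier_vec (dA * dB)" "v \<bullet>c v = 1"
    and \<rho>v: "\<rho> = mat (dA * dB) (dA * dB) (\<lambda>(i, j). v $ i * cnj (v $ j))"
    using pure unfolding pure_state_def by blast
  define \<psi> where "\<psi> i = v $ i" for i
  have \<rho>: "\<rho> = rank1 (dA * dB) \<psi>" unfolding \<rho>v rank1_def \<psi>_def ..
  have \<psi>1: "cip (dA * dB) \<psi> \<psi> = 1"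
    using v by (simp add: scalar_prod_def cip_def \<psi>_def atLeast0LessThan mult.commute)
  \<comment> \<open>A zero dimension would make the norm of \<psi> an empty sum, not 1.\<close>
  have dims: "0 < dA" "0 < dB" using \<psi>1 by (auto simp: cip_def intro!: Nat.gr0I)
  let ?\<rho>A = "partial_trace_B dA dB \<rho>"
  have idx: "a * dB + b < dA * dB" if "a < dA" "b < dB" for a b
  proof -
    have "a * dB + b < Suc a * dB" using that by simp
    also have "\<dots> \<le> dA * dB" using that by (intro mult_le_mono1) simp
    finally show ?thesis .
  qed
  have A: "?\<rho>A \<in> carrier_mat dA dA" by (simp add: partial_trace_B_def)
  have Aij: "?\<rho>A $$ (i, j) = (\<Sum>b<dB. \<psi> (i * dB + b) * cnj (\<psi> (j * dB + b)))"
    if "i < dA" "j < dA" for i j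
    using that by (simp add: partial_trace_B_def \<rho> idx)
  have "hermitian ?\<rho>A"
    unfolding hermitian_index[OF A] by (simp add: Aij mult.commute)
  then obtain u p where u: "onb dA u" and Au: "?\<rho>A = spec_mat dA u p"
    using hermitian_eq_spec_mat[OF A] by blast
  \<comment> \<open>The partial inner product of \<open>u r\<close> with \<psi>. The Gram matrix of
    these vectors is the transpose of the reduced state written in its eigenbasis, hence
    diagonal.\<close>
  define w where "w r b = (\<Sum>a<dA. cnj (u r a) * \<psi> (a * dB + b))" for r b
  have w: "cip dB (w r) (w s) = (if r = s then complex_of_real (p r) else 0)" if rs: "r < dA" "s < dA" for r s
  proof -
    have "cip dB (w r) (w s)
        = (\<Sum>b<dB. \<Sum>a<dA. \<Sum>a'<dA. u r a * cnj (\<psi> (a * dB + b)) * (cnj (u s a') * \<psi> (a' * dB + b)))"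
      by (simp add: cip_def w_def sum_product)
    also have "\<dots> = (\<Sum>a<dA. \<Sum>b<dB. \<Sum>a'<dA. u r a * cnj (\<psi> (a * dB + b)) * (cnj (u s a') * \<psi> (a' * dB + b)))"
      by (rule sum.swap)
    also have "\<dots> = (\<Sum>a<dA. \<Sum>a'<dA. \<Sum>b<dB. u r a * cnj (\<psi> (a * dB + b)) * (cnj (u s a') * \<psi> (a' * dB + b)))"
      by (rule sum.cong[OF refl], rule sum.swap)
    also have "\<dots> = (\<Sum>a<dA. \<Sum>a'<dA. cnj (u s a') * ?\<rho>A $$ (a', a) * u r a)"
      by (intro sum.cong refl)
        (auto simp: Aij sum_distrib_left sum_distrib_right mult_ac intro!: sum.cong)
    also have "\<dots> = bform dA (u s) ?\<rho>A (u r)" unfolding bform_def by (rule sum.swap)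
    also have "\<dots> = (if r = s then complex_of_real (p r) else 0)"
      unfolding Au bform_spec_basis[OF u rs(2)] using onb_cip[OF u rs(2,1)] by simp
    finally show ?thesis .
  qed
  have \<psi>_sum: "\<psi> I = (\<Sum>i<dA. tens dB (u i) (w i) I)" if "I < dA * dB" for I
  proof -
    have "(\<Sum>i<dA. tens dB (u i) (w i) I)
        = (\<Sum>i<dA. cip dA (u i) (\<lambda>a. \<psi> (a * dB + I mod dB)) * u i (I div dB))"
      by (simp add: tens_def w_def cip_def mult.commute)
    also have "\<dots> = \<psi> (I div dB * dB + I mod dB)"
      by (rule onb_expansion[OF u]) (rule product_index[OF that])
    finally show ?thesis by simp
  qed
  \<comment> \<open>The trace of the reduced state is the squared norm of \<psi>, which makes the
    eigenvalues sum to 1.\<close>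
  have "mat_trace ?\<rho>A = (\<Sum>a<dA. \<Sum>b<dB. cnj (\<psi> (a * dB + b)) * \<psi> (a * dB + b))"
    using A by (simp add: mat_trace_def Aij mult.commute)
  also have "\<dots> = (\<Sum>I<dA * dB. cnj (\<psi> (I div dB * dB + I mod dB)) * \<psi> (I div dB * dB + I mod dB))"
    by (rule sum_div_mod[symmetric])
  also have "\<dots> = 1" using \<psi>1 by (simp add: cip_def)
  finally have "(\<Sum>r<dA. p r) = 1"
    unfolding Au spec_mat_trace[OF u] by (metis of_real_eq_1_iff)
  then have "schmidt dA dB dA u w p \<psi>"
    using dims onb_cip[OF u] w \<psi>_sum by unfold_locales auto
  then show thesis using that \<rho> u Au by blast
qed

theorem corollary5p32:
  fixes dA dB :: nat and \<rho> :: "complex mat"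
  assumes "pure_state (dA * dB) \<rho>"
  shows "log2_ereal (asymptotic_gamma_SEP dA dB \<rho>)
           = ereal (von_neumann_entropy (partial_trace_B dA dB \<rho>))"
proof -
  obtain u w p \<psi> where S: "schmidt dA dB dA u w p \<psi>" and \<rho>: "\<rho> = rank1 (dA * dB) \<psi>"
    and u: "onb dA u" and A: "partial_trace_B dA dB \<rho> = spec_mat dA u p"
    by (rule pure_state_schmidt[OF assms])
  have "asymptotic_gamma_SEP dA dB \<rho> = ereal (2 powr (- (\<Sum>r<dA. p r * log 2 (p r))))"
    unfolding \<rho> by (rule schmidt.asymptotic_gamma_eq[OF S refl])
  then show ?thesis
    unfolding A von_neumann_entropy_spec_mat[OF u] by (simp add: log2_ereal_def not_le)
qed

end
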